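(* Let $d\ge 0$ be an integer, let $F\in Q_d$ be a homogeneous real bivariate form of degree $d$, and fix an integer $i$ with $0\leq i\leq \lfloor d/2\rfloor$. If the Toeplitz matrix $\phi^i_d(F)$ is totally nonnegative, then $A_F$ satisfies mixed HRR$_i$ on $U=\{ax+by \mid (a,b)\in\mathbb{R}^2_{>0}\}$. In particular, $\phi^i_d(F)$ is totally nonnegative if and only if $\phi^i_d(F)$ is strongly totally nonnegative (i.e. $\phi^j_d(F)$ is totally nonnegative for every $0\le j\le i$).
   Context: $Q=\mathbb{R}[X,Y]$ with its standard grading, $Q_d$ is the space of forms of degree $d$. $R=\mathbb{R}[x,y]$ acts on $Q$ by differentiation: $x\circ F=\partial F/\partial X$, $y\circ F=\partial F/\partial Y$. For $F\in Q_d$, $\operatorname{Ann}(F)=\{\alpha\in R\mid \alpha\circ F=0\}$ and $A_F=R/\operatorname{Ann}(F)$, a graded Artinian Gorenstein algebra, oriented by the linear map $\int_F:(A_F)_d\to\mathbb{R}$, $\int_F\alpha=\alpha\circ F$. Linear forms in $R_1$ are also regarded as elements of $A_F$. Write $F=\sum_{k=0}^d\binom{d}{k}c_kX^kY^{d-k}$. For $0\le j\le\lfloor d/2\rfloor$ the $j$-th Toeplitz matrix of $F$ is the $(j+1)\times(d-j+1)$ matrix $\phi^j_d(F)=(c_{j+q-p})_{0\leq p\leq j,\ 0\leq q\leq d-j}$. A matrix is totally nonnegative if all its minors (of all sizes) are $\geq 0$. The matrix $\phi^i_d(F)$ is strongly totally nonnegative if $\phi^j_d(F)$ is totally nonnegative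 for every $j$ with $0\leq j\leq i$. Mixed HRR$_i$ on $U$: $A_F$ satisfies the mixed Hodge–Riemann relations up to degree $i$ on $U$ if for every sequence $(\ell_0,\ell_1,\ldots,\ell_d)\in U^{d+1}$, every $j$ with $0\leq j\leq i$, and every nonzero $\alpha\in (A_F)_j$ that is primitive, i.e. $\ell_0\ell_1\cdots\ell_{d-2j}\,\alpha=0$ in $A_F$, one has $(-1)^j\int_F \ell_1\cdots\ell_{d-2j}\,\alpha^2>0$ (the empty product being $1$). *)

theory Defs
  imports
    Complex_Main
    "HOL-Computational_Algebra.Polynomial"
    "HOL-Algebra.QuotRing"
    "Jordan_Normal_Form.VS_Connect"
    "Jordan_Normal_Form.DL_Submatrix"
begin

section \<open>Bivariate real polynomials and the action by differentiation\<close>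

text \<open>Both \<open>Q = \<real>[X,Y]\<close> and \<open>R = \<real>[x,y]\<close> are represented by the type \<open>real poly poly\<close>, with the
  first variable inside: \<open>coeff (coeff P b) a\<close> is the coefficient of \<open>X\<^sup>a Y\<^sup>b\<close> in \<open>P\<close>.\<close>

type_synonym bipoly = "real poly poly"

definition const :: "real \<Rightarrow> bipoly" where
  "const c = [:[:c:]:]"

definition var_x :: bipoly where
  "var_x = [:[:0, 1:]:]"

definition var_y :: bipoly where
  "var_y = [:0, 1:]"

text \<open>The forms of degree \<open>d\<close>, including the zero polynomial.\<close>

definition forms :: "nat \<Rightarrow> bipoly set" where
  "forms d = {P. \<forall>a b. coeff (coeff P b) a \<noteq> 0 \<longrightarrow> a + b = d}"

definition diff_X :: "bipoly \<Rightarrow> bipoly" where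
  "diff_X = map_poly pderiv"

definition diff_Y :: "bipoly \<Rightarrow> bipoly" where
  "diff_Y = pderiv"

definition act :: "bipoly \<Rightarrow> bipoly \<Rightarrow> bipoly" (infixr \<open>\<Zcomp>\<close> 75) where
  "\<alpha> \<Zcomp> F = (\<Sum>b\<le>degree \<alpha>. \<Sum>a\<le>degree (coeff \<alpha> b).
              const (coeff (coeff \<alpha> b) a) * (diff_X ^^ a) ((diff_Y ^^ b) F))"

section \<open>The oriented algebra \<open>A\<^sub>F\<close>\<close>

definition Ann :: "bipoly \<Rightarrow> bipoly set" where
  "Ann F = {\<alpha>. \<alpha> \<Zcomp> F = 0}"

definition A_alg :: "bipoly \<Rightarrow> bipoly set ring" where
  "A_alg F = class_ring Quot (Ann F)"

definition cls :: "bipoly \<Rightarrow> bipoly \<Rightarrow> bipoly set" where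
  "cls F \<alpha> = Ann F +>\<^bsub>class_ring\<^esub> \<alpha>"

definition A_deg :: "bipoly \<Rightarrow> nat \<Rightarrow> bipoly set set" where
  "A_deg F j = cls F ` forms j"

text \<open>For \<open>F\<close> of degree \<open>d\<close> this is meant for \<open>C\<close> in \<open>A_deg F d\<close>, where \<open>\<alpha> \<Zcomp> F\<close> is a constant
  polynomial that does not depend on the representative \<open>\<alpha>\<close> of \<open>C\<close>;
  see \<open>integral_cls\<close> below.\<close>

definition integral_A :: "bipoly \<Rightarrow> bipoly set \<Rightarrow> real" where
  "integral_A F C = (THE c. \<forall>\<alpha>\<in>C. \<alpha> \<Zcomp> F = const c)"

section \<open>Mixed Hodge--Riemann relations\<close>

definition mixed_HRR :: "nat \<Rightarrow> bipoly \<Rightarrow> nat \<Rightarrow> bipoly set \<Rightarrow> bool" where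
  "mixed_HRR d F i U \<longleftrightarrow>
     (\<forall>l :: nat \<Rightarrow> bipoly. (\<forall>k\<le>d. l k \<in> U) \<longrightarrow>
       (\<forall>j\<le>i. \<forall>\<alpha>\<in>A_deg F j.
          \<alpha> \<noteq> \<zero>\<^bsub>A_alg F\<^esub> \<longrightarrow>
          cls F (\<Prod>k=0..d - 2*j. l k) \<otimes>\<^bsub>A_alg F\<^esub> \<alpha> = \<zero>\<^bsub>A_alg F\<^esub> \<longrightarrow>
          (-1) ^ j * integral_A F
            (cls F (\<Prod>k=1..d - 2*j. l k) \<otimes>\<^bsub>A_alg F\<^esub> (\<alpha> [^]\<^bsub>A_alg F\<^esub> (2::nat))) > 0))"

definition positive_linear_forms :: "bipoly set" where
  "positive_linear_forms = {const a * var_x + const b * var_y | a b. a > 0 \<and> b > 0}"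

section \<open>Toeplitz matrices and total nonnegativity\<close>

definition norm_coeff :: "nat \<Rightarrow> bipoly \<Rightarrow> nat \<Rightarrow> real" where
  "norm_coeff d F k = coeff (coeff F (d - k)) k / real (d choose k)"

definition toeplitz :: "nat \<Rightarrow> nat \<Rightarrow> bipoly \<Rightarrow> real mat" where
  "toeplitz d j F = mat (j + 1) (d - j + 1) (\<lambda>(p, q). norm_coeff d F (j + q - p))"

definition totally_nonneg :: "real mat \<Rightarrow> bool" where
  "totally_nonneg M \<longleftrightarrow>
     (\<forall>I J. I \<subseteq> {..<dim_row M} \<longrightarrow> J \<subseteq> {..<dim_col M} \<longrightarrow> card I = card J \<longrightarrow>
        det (submatrix M I J) \<ge> 0)"

definition strongly_totally_nonneg_toeplitz :: "nat \<Rightarrow> nat \<Rightarrow> bipoly \<Rightarrow> bool" where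
  "strongly_totally_nonneg_toeplitz d i F \<longleftrightarrow> (\<forall>j\<le>i. totally_nonneg (toeplitz d j F))"

section \<open>Well-definedness\<close>

lemma form_expansion:
  assumes "F \<in> forms d"
  shows "F = (\<Sum>k\<le>d. const (real (d choose k) * norm_coeff d F k) * var_x ^ k * var_y ^ (d - k))"
proof (intro poly_eqI)
  fix b a
  have m: "const c * var_x ^ k * var_y ^ m = monom (monom c k) m" for c k m
  proof -
    have "var_x ^ k = [:monom 1 k:]"
      by (induction k) (simp_all add: var_x_def monom_Suc one_pCons)
    moreover have "var_y ^ m = monom 1 m"
      by (induction m) (simp_all add: var_y_def monom_Suc)
    ultimately show ?thesis
      by (simp add: const_def smult_monom)
  qed
  have "coeff (coeff (\<Sum>k\<le>d. monom (monom (real (d choose k) * norm_coeff d F k) k) (d - k)) b) a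
      = (\<Sum>k\<le>d. if k = a then (if d - a = b then coeff (coeff F (d - a)) a else 0) else 0)"
    unfolding coeff_sum
    by (intro sum.cong) (auto simp: norm_coeff_def)
  also have "\<dots> = (if a \<le> d \<and> d - a = b then coeff (coeff F b) a else 0)"
    by (auto simp: sum.delta)
  also have "\<dots> = coeff (coeff F b) a"
    using assms unfolding forms_def by fastforce
  finally show "coeff (coeff F b) a = coeff (coeff (\<Sum>k\<le>d.
      const (real (d choose k) * norm_coeff d F k) * var_x ^ k * var_y ^ (d - k)) b) a"
    by (simp add: m)
qed

lemma diff_X_add: "diff_X (P + Q) = diff_X P + diff_X Q"
  unfolding diff_X_def by (intro poly_eqI) (simp add: coeff_map_poly pderiv_add)

lemma diff_Y_add: "diff_Y (P + Q) = diff_Y P + diff_Y Q"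
  unfolding diff_Y_def by (simp add: pderiv_add)

lemma diff_X_const: "diff_X (const c * P) = const c * diff_X P"
  unfolding diff_X_def const_def by (intro poly_eqI) (simp add: coeff_map_poly pderiv_smult)

lemma diff_Y_const: "diff_Y (const c * P) = const c * diff_Y P"
  unfolding diff_Y_def const_def by (simp add: pderiv_smult)

lemma diff_XY: "diff_X (diff_Y P) = diff_Y (diff_X P)"
  unfolding diff_Y_def diff_X_def
  by (intro poly_eqI)
     (simp add: coeff_map_poly coeff_pderiv of_nat_poly pderiv_smult del: of_nat_Suc)

lemma diff_0 [simp]: "diff_X 0 = 0" "diff_Y 0 = 0"
  by (simp_all add: diff_X_def diff_Y_def)

lemma diff_X_pow:
  "(diff_X ^^ n) (P + Q) = (diff_X ^^ n) P + (diff_X ^^ n) Q"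
  "(diff_X ^^ n) (const c * P) = const c * (diff_X ^^ n) P"
  "(diff_X ^^ n) 0 = 0"
  "(diff_X ^^ n) (diff_X P) = diff_X ((diff_X ^^ n) P)"
  "(diff_X ^^ n) (diff_Y P) = diff_Y ((diff_X ^^ n) P)"
  by (induction n) (simp_all add: diff_X_add diff_X_const diff_XY)

lemma diff_Y_pow:
  "(diff_Y ^^ n) (P + Q) = (diff_Y ^^ n) P + (diff_Y ^^ n) Q"
  "(diff_Y ^^ n) (const c * P) = const c * (diff_Y ^^ n) P"
  "(diff_Y ^^ n) 0 = 0"
  "(diff_Y ^^ n) (diff_X P) = diff_X ((diff_Y ^^ n) P)"
  "(diff_Y ^^ n) (diff_Y P) = diff_Y ((diff_Y ^^ n) P)"
  by (induction n) (simp_all add: diff_Y_add diff_Y_const diff_XY)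

definition act_X :: "real poly \<Rightarrow> bipoly \<Rightarrow> bipoly" where
  "act_X p F = (\<Sum>a\<le>degree p. const (coeff p a) * (diff_X ^^ a) F)"

lemma act_eq: "\<alpha> \<Zcomp> F = (\<Sum>b\<le>degree \<alpha>. act_X (coeff \<alpha> b) ((diff_Y ^^ b) F))"
  by (simp add: act_def act_X_def)

lemma const_0 [simp]: "const 0 = 0" "const 1 = 1"
  by (simp_all add: const_def one_pCons)

lemma act_X_bound: "degree p \<le> n \<Longrightarrow> act_X p F = (\<Sum>a\<le>n. const (coeff p a) * (diff_X ^^ a) F)"
  unfolding act_X_def by (rule sum.mono_neutral_left) (auto simp: coeff_eq_0)

lemma act_X_0 [simp]: "act_X 0 F = 0"
  by (simp add: act_X_def)

lemma act_bound: "degree \<alpha> \<le> n \<Longrightarrow> \<alpha> \<Zcomp> F = (\<Sum>b\<le>n. act_X (coeff \<alpha> b) ((diff_Y ^^ b) F))"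
  unfolding act_eq by (rule sum.mono_neutral_left) (auto simp: coeff_eq_0)

lemma act_X_add_left: "act_X (p + q) F = act_X p F + act_X q F"
proof -
  let ?n = "max (degree p) (degree q)"
  have "degree (p + q) \<le> ?n" by (rule degree_add_le_max)
  moreover have "const (a + b) = const a + const b" for a b by (simp add: const_def)
  ultimately show ?thesis
    by (simp add: act_X_bound[of _ ?n] sum.distrib ring_distribs)
qed

lemma act_add_left: "(\<alpha> + \<beta>) \<Zcomp> F = \<alpha> \<Zcomp> F + \<beta> \<Zcomp> F"
proof -
  let ?n = "max (degree \<alpha>) (degree \<beta>)"
  have "degree (\<alpha> + \<beta>) \<le> ?n" by (rule degree_add_le_max)
  then show ?thesis
    by (simp add: act_bound[of _ ?n] sum.distrib act_X_add_left)
qed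

lemma act_X_pCons: "act_X (pCons c p) F = const c * F + act_X p (diff_X F)"
proof -
  have "act_X (pCons c p) F = (\<Sum>a\<le>Suc (degree p). const (coeff (pCons c p) a) * (diff_X ^^ a) F)"
    by (rule act_X_bound) (rule degree_pCons_le)
  then show ?thesis
    by (simp add: sum.atMost_Suc_shift act_X_def diff_X_pow del: sum.atMost_Suc)
qed

lemma act_pCons: "pCons p \<alpha> \<Zcomp> F = act_X p F + \<alpha> \<Zcomp> diff_Y F"
proof -
  have "pCons p \<alpha> \<Zcomp> F = (\<Sum>b\<le>Suc (degree \<alpha>). act_X (coeff (pCons p \<alpha>) b) ((diff_Y ^^ b) F))"
    by (rule act_bound) (rule degree_pCons_le)
  then show ?thesis
    by (simp add: sum.atMost_Suc_shift act_eq diff_Y_pow del: sum.atMost_Suc)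
qed

lemma act_0_left [simp]: "0 \<Zcomp> F = 0"
  by (simp add: act_eq)

lemma act_X_right:
  "act_X p (F + G) = act_X p F + act_X p G"
  "act_X p (const c * F) = const c * act_X p F"
  "act_X p 0 = 0"
  "act_X p (diff_X F) = diff_X (act_X p F)"
  "act_X p (diff_Y F) = diff_Y (act_X p F)"
  by (induction p arbitrary: F G)
     (simp_all add: act_X_pCons diff_X_add diff_Y_add diff_X_const diff_Y_const diff_XY
       distrib_left add_ac mult.left_commute)

lemma act_right:
  "\<alpha> \<Zcomp> (F + G) = \<alpha> \<Zcomp> F + \<alpha> \<Zcomp> G"
  "\<alpha> \<Zcomp> (const c * F) = const c * (\<alpha> \<Zcomp> F)"
  "\<alpha> \<Zcomp> 0 = 0"
  "\<alpha> \<Zcomp> diff_X F = diff_X (\<alpha> \<Zcomp> F)"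
  "\<alpha> \<Zcomp> diff_Y F = diff_Y (\<alpha> \<Zcomp> F)"
  by (induction \<alpha> arbitrary: F G)
     (simp_all add: act_pCons act_X_right diff_X_add diff_Y_add diff_X_const diff_Y_const diff_XY
       distrib_left add_ac mult.left_commute)

lemma act_X_smult: "act_X (Polynomial.smult c p) F = const c * act_X p F"
  by (induction p arbitrary: F)
     (simp_all add: act_X_pCons algebra_simps, simp add: const_def algebra_simps)

lemma act_X_mult: "act_X (p * q) F = act_X p (act_X q F)"
  by (induction p arbitrary: F)
     (simp_all add: act_X_pCons act_X_add_left act_X_smult act_X_right)

lemma act_smult: "Polynomial.smult p \<alpha> \<Zcomp> F = act_X p (\<alpha> \<Zcomp> F)"
  by (induction \<alpha> arbitrary: F) (simp_all add: act_pCons act_X_mult act_X_right)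

lemma act_mult: "(\<alpha> * \<beta>) \<Zcomp> F = \<alpha> \<Zcomp> (\<beta> \<Zcomp> F)"
  by (induction \<alpha> arbitrary: F)
     (simp_all add: act_pCons act_add_left act_smult act_right)

lemma act_X_1 [simp]: "act_X 1 F = F"
  by (simp add: act_X_def)

lemma act_generators:
  "const c \<Zcomp> F = const c * F" "var_x \<Zcomp> F = diff_X F" "var_y \<Zcomp> F = diff_Y F"
proof -
  show "const c \<Zcomp> F = const c * F"
    unfolding const_def[of c] by (simp add: act_pCons act_X_pCons const_def)
  show "var_x \<Zcomp> F = diff_X F"
    unfolding var_x_def by (simp add: act_pCons act_X_pCons)
  show "var_y \<Zcomp> F = diff_Y F"
    unfolding var_y_def by (simp add: act_pCons)
qed

lemma cring_class: "cring (class_ring :: bipoly ring)"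
  by unfold_locales (auto simp: algebra_simps intro: exI[of _ "- _"])

lemma ideal_Ann: "ideal (Ann F) (class_ring :: bipoly ring)"
proof (rule idealI)
  show "ring (class_ring :: bipoly ring)"
    using cring_class by (rule cring.axioms)
next
  have "- \<alpha> \<Zcomp> F = 0" if "\<alpha> \<Zcomp> F = 0" for \<alpha>
    using act_add_left[of "- \<alpha>" \<alpha> F] that by simp
  moreover have "(THE y. \<alpha> + y = 0 \<and> y + \<alpha> = 0) = - \<alpha>" for \<alpha> :: bipoly
    by (rule the_equality) (simp, metis minus_unique)
  ultimately show "subgroup (Ann F) (add_monoid (class_ring :: bipoly ring))"
    by unfold_locales
       (auto simp: Ann_def act_add_left m_inv_def)
next
  fix \<alpha> \<beta> assume "\<alpha> \<in> Ann F"
  then have "(\<beta> * \<alpha>) \<Zcomp> F = 0" by (simp add: Ann_def act_mult act_right)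
  then show "\<beta> \<otimes>\<^bsub>class_ring\<^esub> \<alpha> \<in> Ann F" "\<alpha> \<otimes>\<^bsub>class_ring\<^esub> \<beta> \<in> Ann F"
    by (simp_all add: Ann_def mult.commute)
qed

lemma cring_A_alg: "cring (A_alg F)"
  unfolding A_alg_def by (rule ideal.quotient_is_cring[OF ideal_Ann cring_class])

lemma act_forms_const:
  assumes "F \<in> forms d" "\<alpha> \<in> forms d"
  shows "\<exists>c. \<alpha> \<Zcomp> F = const c"
proof -
  have X: "coeff (coeff (diff_X P) b) a = 0" if "coeff (coeff P b) (Suc a) = 0" for P a b
    using that by (simp add: diff_X_def coeff_map_poly coeff_pderiv)
  have Y: "coeff (coeff (diff_Y P) b) a = 0" if "coeff (coeff P (Suc b)) a = 0" for P a b
  proof -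
    have "coeff (of_nat m * p) a = of_nat m * coeff p a" for m and p :: "real poly"
      by (simp add: of_nat_poly)
    then show ?thesis
      using that by (simp only: diff_Y_def coeff_pderiv)
  qed
  have XX: "coeff (coeff ((diff_X ^^ m) P) b) a = 0" if "coeff (coeff P b) (a + m) = 0" for P a b m
    using that by (induction m arbitrary: a) (auto intro!: X)
  have YY: "coeff (coeff ((diff_Y ^^ m) P) b) a = 0" if "coeff (coeff P (b + m)) a = 0" for P a b m
    using that by (induction m arbitrary: b) (auto intro!: Y)
  have "coeff (coeff (\<alpha> \<Zcomp> F) b) a = 0" if ab: "a + b \<noteq> 0" for a b
  proof -
    have "coeff (coeff (const (coeff (coeff \<alpha> n) m) * (diff_X ^^ m) ((diff_Y ^^ n) F)) b) a = 0" for m n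
    proof (cases "coeff (coeff \<alpha> n) m = 0")
      case False
      with assms(2) have "m + n = d" unfolding forms_def by blast
      with ab have "(a + m) + (b + n) \<noteq> d" by linarith
      with assms(1) have "coeff (coeff F (b + n)) (a + m) = 0" unfolding forms_def by blast
      then have "coeff (coeff ((diff_X ^^ m) ((diff_Y ^^ n) F)) b) a = 0"
        by (intro XX YY)
      then show ?thesis by (simp add: const_def)
    qed simp
    then show ?thesis by (simp add: act_def coeff_sum)
  qed
  then have "\<alpha> \<Zcomp> F = const (coeff (coeff (\<alpha> \<Zcomp> F) 0) 0)"
    unfolding const_def by (intro poly_eqI) (simp add: coeff_pCons split: nat.split)
  then show ?thesis ..
qed

lemma integral_cls:
  assumes "F \<in> forms d" "\<alpha> \<in> forms d"
  shows "\<alpha> \<Zcomp> F = const (integral_A F (cls F \<alpha>))"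
proof -
  obtain c where c: "\<alpha> \<Zcomp> F = const c" using act_forms_const[OF assms] by blast
  have all: "\<beta> \<Zcomp> F = const c" if "\<beta> \<in> cls F \<alpha>" for \<beta>
    using that c by (auto simp: cls_def a_r_coset_def r_coset_def Ann_def act_add_left)
  have mem: "\<alpha> \<in> cls F \<alpha>"
    by (auto simp: cls_def a_r_coset_def r_coset_def Ann_def intro!: exI[of _ 0])
  have "integral_A F (cls F \<alpha>) = c"
    unfolding integral_A_def
    by (rule the_equality) (use all mem in \<open>auto simp: const_def\<close>)
  then show ?thesis by (simp add: c)
qed

end

theory Submission
  imports Defs
begin

text \<open>
  Setting \<open>y = 1\<close> turns forms into univariate polynomials in \<open>t\<close>, and the pairing with \<open>F\<close> becomes, up to
  factorials, the functional sending \<open>t\<^sup>k\<close> to \<open>c\<^sub>k\<close>. Differentiating \<open>F\<close> by \<open>ax + by\<close> multiplies a Toeplitz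
  matrix by a bidiagonal one, from either side. So if \<open>\<phi>\<^sup>i(F)\<close> is totally nonnegative of rank \<open>r\<close>, then
  after \<open>d - 2(k - 1)\<close> derivatives along positive linear forms the square Toeplitz determinant of
  size \<open>k\<close> is positive for \<open>k \<le> r\<close> and zero for \<open>k = r + 1\<close>.

  In degree \<open>j < r\<close> these determinants, read as Gram determinants for \<open>l\<^sub>0, l\<^sub>0 t, \<dots>, l\<^sub>0 t\<^sup>j\<^sup>-\<^sup>1, \<alpha>\<close> with
  \<open>\<alpha>\<close> primitive, give the sign of the form at \<open>\<alpha>\<close>. In degree \<open>j \<ge> r\<close> every primitive class vanishes,
  because \<open>\<phi>\<^sup>j(F)\<close> has rank at most \<open>r\<close>.

  For strong total nonnegativity, substitute \<open>x + \<epsilon>y\<close> and \<open>y + \<epsilon>x\<close> for \<open>x\<close> and \<open>y\<close>. The consecutive minors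
  of the new \<open>\<phi>\<^sup>j\<close> are positive multiples of the determinants above, so Fekete's criterion makes all
  minors of size at most \<open>r\<close> positive and those of size \<open>r + 1\<close> zero. Let \<open>\<epsilon> \<rightarrow> 0\<close>.
\<close>

section \<open>Minors and increasing index maps\<close>

text \<open>Only the values of \<open>f\<close> and \<open>g\<close> below \<open>k\<close> matter.\<close>

definition minor :: "nat \<Rightarrow> (nat \<Rightarrow> nat \<Rightarrow> real) \<Rightarrow> (nat \<Rightarrow> nat) \<Rightarrow> (nat \<Rightarrow> nat) \<Rightarrow> real" where
  "minor k M f g = det (mat k k (\<lambda>(a, b). M (f a) (g b)))"

text \<open>Increasing enumerations of the \<open>k\<close>-element row or column sets. Values from
  \<open>k\<close> on are left free, so one set has many representatives.\<close>

definition idx :: "nat \<Rightarrow> nat \<Rightarrow> (nat \<Rightarrow> nat) set" where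
  "idx k m = {f. strict_mono_on {..<k} f \<and> f ` {..<k} \<subseteq> {..<m}}"

text \<open>Precomposition with \<open>skip s\<close> deletes position \<open>s\<close>, as
  \<open>mat_delete\<close> does to rows and columns.\<close>

definition skip :: "nat \<Rightarrow> nat \<Rightarrow> nat" where
  "skip s q = (if q < s then q else Suc q)"

section \<open>Laplace expansion, transposition and multilinearity of minors\<close>

lemma minor_cong:
  assumes "\<And>a b. a < k \<Longrightarrow> b < k \<Longrightarrow> M (f a) (g b) = M' (f' a) (g' b)"
  shows "minor k M f g = minor k M' f' g'"
  unfolding minor_def by (rule arg_cong[where f = det], rule cong_mat) (auto simp: assms)

lemma minor_0 [simp]: "minor 0 M f g = 1"
  by (simp add: minor_def)

lemma minor_transpose: "minor k M f g = minor k (\<lambda>p q. M q p) g f"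
proof -
  have "transpose_mat (mat k k (\<lambda>(a, b). M (f a) (g b))) = mat k k (\<lambda>(a, b). M (f b) (g a))"
    by (rule eq_matI) auto
  then show ?thesis
    unfolding minor_def by (metis det_transpose mat_carrier)
qed

lemma minor_repeated_col:
  assumes "a < k" "b < k" "a \<noteq> b" "g a = g b"
  shows "minor k M f g = 0"
  unfolding minor_def
  by (rule det_identical_columns[of _ k a b]) (use assms in \<open>auto intro!: eq_vecI\<close>)

lemma minor_laplace_col:
  assumes "s \<le> k"
  shows "minor (Suc k) M f g =
    (\<Sum>p\<le>k. (-1) ^ (p + s) * M (f p) (g s) * minor k M (f \<circ> skip p) (g \<circ> skip s))"
proof -
  let ?A = "mat (Suc k) (Suc k) (\<lambda>(a, b). M (f a) (g b))"
  have "minor (Suc k) M f g = (\<Sum>p<Suc k. ?A $$ (p, s) * cofactor ?A p s)"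
    unfolding minor_def by (rule laplace_expansion_column) (use assms in auto)
  also have "\<dots> = (\<Sum>p\<le>k. (-1) ^ (p + s) * M (f p) (g s) * minor k M (f \<circ> skip p) (g \<circ> skip s))"
  proof (rule sum.cong)
    fix p assume "p \<in> {..k}"
    then have "p \<le> k" by simp
    moreover have "mat_delete ?A p s = mat k k (\<lambda>(a, b). M ((f \<circ> skip p) a) ((g \<circ> skip s) b))"
      by (rule eq_matI) (auto simp: mat_delete_def skip_def)
    ultimately show "?A $$ (p, s) * cofactor ?A p s =
        (-1) ^ (p + s) * M (f p) (g s) * minor k M (f \<circ> skip p) (g \<circ> skip s)"
      using assms by (simp add: cofactor_def minor_def)
  qed auto
  finally show ?thesis .
qed

lemma minor_laplace_row:
  assumes "s \<le> k"
  shows "minor (Suc k) M f g =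
    (\<Sum>q\<le>k. (-1) ^ (q + s) * M (f s) (g q) * minor k M (f \<circ> skip s) (g \<circ> skip q))"
  unfolding minor_transpose[of "Suc k" M] minor_transpose[of k M]
  by (rule minor_laplace_col[OF assms])

text \<open>Multilinearity in the columns: the Cauchy-Binet formula before its terms are grouped.
  The maps \<open>h\<close> may repeat values, so \<open>P\<close> enters by products instead of
  minors.\<close>

lemma minor_expand:
  assumes "finite A"
  shows "minor k (\<lambda>p b. \<Sum>s\<in>A. M p s * P s b) f g =
    (\<Sum>h\<in>PiE {..<k} (\<lambda>_. A). (\<Prod>b<k. P (h b) (g b)) * minor k M f h)"
proof -
  have "minor k (\<lambda>p b. \<Sum>s\<in>A. M p s * P s b) f g =
    (\<Sum>p | p permutes {0..<k}. signof p * (\<Prod>b<k. \<Sum>s\<in>A. M (f (p b)) s * P s (g b)))"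
    unfolding minor_def by (subst det_col[of _ k]) (auto intro!: sum.cong prod.cong dest: permutes_in_image)
  also have "\<dots> = (\<Sum>p | p permutes {0..<k}. \<Sum>h\<in>PiE {..<k} (\<lambda>_. A).
      signof p * (\<Prod>b<k. M (f (p b)) (h b) * P (h b) (g b)))"
    using assms by (simp add: prod_sum_PiE sum_distrib_left)
  also have "\<dots> = (\<Sum>h\<in>PiE {..<k} (\<lambda>_. A). \<Sum>p | p permutes {0..<k}.
      (\<Prod>b<k. P (h b) (g b)) * (signof p * (\<Prod>b<k. M (f (p b)) (h b))))"
    by (subst sum.swap) (simp add: prod.distrib mult_ac)
  also have "\<dots> = (\<Sum>h\<in>PiE {..<k} (\<lambda>_. A). (\<Prod>b<k. P (h b) (g b)) * minor k M f h)"
    unfolding minor_def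
    by (subst det_col[of _ k])
       (auto intro!: sum.cong prod.cong arg_cong2[where f = "(*)"] dest: permutes_in_image
         simp: sum_distrib_left)
  finally show ?thesis .
qed

section \<open>Increasing index maps\<close>

lemma idx_mono: "f \<in> idx k m \<Longrightarrow> a < b \<Longrightarrow> b < k \<Longrightarrow> f a < f b"
  by (auto simp: idx_def strict_mono_on_def)

lemma idx_bound: "f \<in> idx k m \<Longrightarrow> a < k \<Longrightarrow> f a < m"
  by (auto simp: idx_def)

lemma idxI: "(\<And>a b. a < b \<Longrightarrow> b < k \<Longrightarrow> f a < f b) \<Longrightarrow> (\<And>a. a < k \<Longrightarrow> f a < m) \<Longrightarrow> f \<in> idx k m"
  by (auto simp: idx_def strict_mono_on_def)

lemma idx_sucI:
  assumes "\<And>a. Suc a < k \<Longrightarrow> f a < f (Suc a)" "\<And>a. a < k \<Longrightarrow> f a < m"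
  shows "f \<in> idx k m"
proof (rule idxI)
  fix a b assume "a < b" "b < k"
  then show "f a < f b"
  proof (induction b)
    case (Suc b)
    then show ?case using assms(1)[of b] by (cases "a = b") auto
  qed simp
qed (rule assms(2))

lemma idx_lower: "f \<in> idx k m \<Longrightarrow> a \<le> b \<Longrightarrow> b < k \<Longrightarrow> f a + (b - a) \<le> f b"
proof (induction b)
  case (Suc b)
  show ?case
  proof (cases "a = Suc b")
    case False
    then have "f a + (b - a) \<le> f b" using Suc by simp
    moreover have "f b < f (Suc b)" using Suc idx_mono by blast
    ultimately show ?thesis using False Suc by linarith
  qed simp
qed simp

lemma idx_le: "f \<in> idx k m \<Longrightarrow> k \<le> m"
  using idx_lower[of f k m 0 "k - 1"] idx_bound[of f k m "k - 1"] by (cases k) auto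

lemma idx_self:
  assumes "f \<in> idx k k" "a < k" shows "f a = a"
proof -
  have "f 0 + (a - 0) \<le> f a" using assms idx_lower[of f k k 0 a] by blast
  moreover have "f a + (k - 1 - a) \<le> f (k - 1)" using assms idx_lower[of f k k a "k - 1"] by auto
  moreover have "f (k - 1) < k" using assms idx_bound[of f k k "k - 1"] by auto
  ultimately show ?thesis using assms by linarith
qed

lemma idx_restrict: "f \<in> idx k m \<Longrightarrow> l \<le> k \<Longrightarrow> f \<in> idx l m"
  by (rule idxI) (auto intro: idx_mono idx_bound)

lemma idx_skip: "h \<in> idx (Suc k) m \<Longrightarrow> h \<circ> skip s \<in> idx k m"
  by (rule idxI) (auto simp: skip_def intro: idx_mono idx_bound)

text \<open>Arbitrary column choices reduce to increasing ones: a repetition gives two equal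
  columns, and an injective choice rearranges the increasing enumeration of its range, which changes
  only the sign.\<close>

lemma minor_zero_idx:
  assumes zero: "\<And>g. g \<in> idx k n \<Longrightarrow> minor k M f g = 0"
    and g: "\<And>a. a < k \<Longrightarrow> g a < n"
  shows "minor k M f g = 0"
proof (cases "inj_on g {..<k}")
  case False
  then show ?thesis using minor_repeated_col unfolding inj_on_def by (metis lessThan_iff)
next
  case True
  let ?S = "g ` {..<k}"
  have card: "card ?S = k" using True by (simp add: card_image)
  have pick: "pick ?S \<in> idx k n"
  proof (rule idxI)
    show "pick ?S a < pick ?S b" if "a < b" "b < k" for a b
      using pick_mono_le[of b ?S a] that card by simp
    show "pick ?S a < n" if "a < k" for a
      using pick_in_set_le[of a ?S] that card g by auto
  qed
  have inj: "inj_on (pick ?S) {..<k}"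
    using idx_mono[OF pick] by (intro linorder_inj_onI) (auto, metis less_irrefl)
  have img: "pick ?S ` {..<k} = ?S"
    using pick_in_set_le[of _ ?S] card inj by (intro card_subset_eq) (auto simp: card_image)
  \<comment> \<open>\<open>p\<close> sends a position in \<open>g\<close> to the position of the
    same column in the sorted list.\<close>
  define p where "p = (\<lambda>a. if a < k then the_inv_into {..<k} (pick ?S) (g a) else a)"
  have pg: "p a < k \<and> pick ?S (p a) = g a" if "a < k" for a
  proof -
    have "g a \<in> pick ?S ` {..<k}" using that img by auto
    then show ?thesis
      using that f_the_inv_into_f[OF inj] the_inv_into_into[OF inj _ subset_refl] by (auto simp: p_def)
  qed
  have p: "p permutes {0..<k}"
  proof (rule bij_imp_permutes)
    have "inj_on p {0..<k}"
      using pg True unfolding inj_on_def by (metis atLeastLessThan_iff lessThan_iff)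
    moreover have "p ` {0..<k} \<subseteq> {0..<k}" using pg by auto
    ultimately show "bij_betw p {0..<k} {0..<k}"
      by (metis bij_betw_def card_image card_subset_eq finite_atLeastLessThan)
  qed (auto simp: p_def)
  \<comment> \<open>The matrix is transposed so that permuted columns become permuted rows.\<close>
  let ?A = "mat k k (\<lambda>(a, b). M (f b) (pick ?S a))"
  have "mat k k (\<lambda>(a, b). M (f b) (g a)) = mat k k (\<lambda>(i, j). ?A $$ (p i, j))"
    by (rule eq_matI) (use pg in auto)
  then have "det (mat k k (\<lambda>(a, b). M (f b) (g a))) = signof p * det ?A"
    using det_permute_rows[of ?A k p] p by simp
  moreover have "det ?A = 0"
    using zero[OF pick] unfolding minor_transpose[of k M] by (simp add: minor_def)
  ultimately show ?thesis
    unfolding minor_transpose[of k M] by (simp add: minor_def)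
qed

text \<open>Laplace expansion along the first column writes the minor through minors of size
  \<open>k\<close>, so these cannot all vanish.\<close>

lemma minor_nonzero_down:
  assumes "minor (Suc k) M f g \<noteq> 0" "f \<in> idx (Suc k) m" "g \<in> idx (Suc k) n"
  obtains f' g' where "f' \<in> idx k m" "g' \<in> idx k n" "minor k M f' g' \<noteq> 0"
proof -
  have "(\<Sum>p\<le>k. (-1) ^ (p + 0) * M (f p) (g 0) * minor k M (f \<circ> skip p) (g \<circ> skip 0)) \<noteq> 0"
    using assms(1) minor_laplace_col[of 0 k M f g] by simp
  then obtain p where "minor k M (f \<circ> skip p) (g \<circ> skip 0) \<noteq> 0"
    by (metis (no_types, lifting) mult_zero_right sum.neutral)
  then show ?thesis using that idx_skip assms by blast
qed

section \<open>Fekete's criterion and bidiagonal products\<close>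

lemma minor_insert_col_zero:
  assumes "q < k"
  shows "(\<Sum>p\<le>k. (-1) ^ p * M (f p) (w q) * minor k M (f \<circ> skip p) w) = 0"
proof -
  \<comment> \<open>Prepending the column \<open>w q\<close> to \<open>w\<close> repeats a column;
    expansion along the new column is the sum in question.\<close>
  let ?g = "\<lambda>a. if a = 0 then w q else w (a - 1)"
  have "minor (Suc k) M f ?g = 0"
    by (rule minor_repeated_col[of 0 _ "Suc q"]) (use assms in auto)
  moreover have "minor k M (f \<circ> skip p) (?g \<circ> skip 0) = minor k M (f \<circ> skip p) w" for p
    by (rule minor_cong) (simp add: skip_def)
  ultimately show ?thesis
    using minor_laplace_col[of 0 k M f ?g] by simp
qed

text \<open>The transposed identity is a linear relation between the \<open>k + 1\<close> columns
  \<open>h\<close> on the rows \<open>f\<close>, with the signed maximal minors as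
  coefficients.\<close>

lemma minor_insert_row_zero:
  assumes "p < k"
  shows "(\<Sum>s\<le>k. (-1) ^ s * M (f p) (h s) * minor k M f (h \<circ> skip s)) = 0"
  using minor_insert_col_zero[OF assms, of "\<lambda>p q. M q p" h f] by (simp add: minor_transpose[of k M])

text \<open>A three-term Pluecker relation. On \<open>k + 2\<close> rows the columns
  \<open>h 0\<close> to \<open>h (k + 2)\<close> satisfy the linear relation with coefficients
  \<open>(-1) ^ s * D s\<close>. The functional \<open>\<Phi>\<close> uses only the first
  \<open>k + 1\<close> rows and kills the columns \<open>W 0\<close> to \<open>W (k - 1)\<close>, so
  applying it leaves \<open>s = 0\<close>, \<open>s = m\<close> and
  \<open>s = k + 2\<close>.\<close>

lemma minor_three_term:
  assumes m: "0 < m" "m \<le> Suc k"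
  shows "minor (k + 2) M f (h \<circ> skip m) * minor (Suc k) M f (h \<circ> skip 0) =
    minor (k + 2) M f (h \<circ> skip 0) * minor (Suc k) M f (h \<circ> skip m) +
    minor (k + 2) M f h * minor (Suc k) M f (h \<circ> skip 0 \<circ> skip (m - 1))"
proof -
  \<comment> \<open>The first \<open>k\<close> values of \<open>W\<close> are \<open>h 1\<close> to
    \<open>h (k + 1)\<close> with \<open>h m\<close> left out; the next one,
    \<open>W k = h (k + 2)\<close>, serves the last minor.\<close>
  define W where "W = h \<circ> skip 0 \<circ> skip (m - 1)"
  define D where "D s = minor (k + 2) M f (h \<circ> skip s)" for s
  define \<Phi> where "\<Phi> v = (\<Sum>p\<le>k. (-1) ^ p * M (f p) v * minor k M (f \<circ> skip p) W)" for v
  \<comment> \<open>\<open>\<Phi> v\<close> is the minor with the column list \<open>v\<close>,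
    \<open>W 0\<close> to \<open>W (k - 1)\<close>; moving \<open>v\<close> to position
    \<open>s\<close> costs the sign.\<close>
  have insert: "minor (Suc k) M f g = (-1) ^ s * \<Phi> (g s)"
    if "s \<le> k" "\<And>q. q < k \<Longrightarrow> g (skip s q) = W q" for g s
  proof -
    have "minor k M (f \<circ> skip p) (g \<circ> skip s) = minor k M (f \<circ> skip p) W" for p
      by (rule minor_cong) (simp add: that)
    then show ?thesis
      unfolding minor_laplace_col[OF that(1)] \<Phi>_def
      by (simp add: sum_distrib_left power_add mult_ac)
  qed
  have "(\<Sum>s\<le>k + 2. (-1) ^ s * D s * \<Phi> (h s)) =
      (\<Sum>s\<le>k + 2. \<Sum>p\<le>k. (-1) ^ p * minor k M (f \<circ> skip p) W * ((-1) ^ s * M (f p) (h s) * D s))"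
    unfolding \<Phi>_def sum_distrib_left by (intro sum.cong) (auto simp: mult_ac)
  also have "\<dots> = (\<Sum>p\<le>k. (-1) ^ p * minor k M (f \<circ> skip p) W * (\<Sum>s\<le>k + 2. (-1) ^ s * M (f p) (h s) * D s))"
    unfolding sum_distrib_left by (rule sum.swap)
  also have "\<dots> = 0"
    unfolding D_def using minor_insert_row_zero[where k = "k + 2"] by (intro sum.neutral) simp
  finally have "(\<Sum>s\<le>k + 2. (-1) ^ s * D s * \<Phi> (h s)) = 0" .
  moreover have "\<Phi> (h s) = 0" if "s \<noteq> 0" "s \<noteq> m" "s < k + 2" for s
  proof -
    have "\<exists>q<k. h s = W q"
    proof (cases "s < m")
      case True
      then show ?thesis using that m by (intro exI[of _ "s - 1"]) (auto simp: W_def skip_def)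
    next
      case False
      then show ?thesis using that m by (intro exI[of _ "s - 2"]) (auto simp: W_def skip_def intro!: arg_cong[of _ _ h])
    qed
    then obtain q where "q < k" "h s = W q" by blast
    then show ?thesis unfolding \<Phi>_def using minor_insert_col_zero by metis
  qed
  then have "(\<Sum>s\<in>{..k + 2} - {0, m, k + 2}. (-1) ^ s * D s * \<Phi> (h s)) = 0"
    by (intro sum.neutral) auto
  ultimately have "(\<Sum>s\<in>{0, m, k + 2}. (-1) ^ s * D s * \<Phi> (h s)) = 0"
    using sum.subset_diff[of "{0, m, k + 2}" "{..k + 2}" "\<lambda>s. (-1) ^ s * D s * \<Phi> (h s)"] m by simp
  then have rel: "D 0 * \<Phi> (h 0) + (-1) ^ m * D m * \<Phi> (h m) + (-1) ^ k * D (k + 2) * \<Phi> (h (k + 2)) = 0"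
    using m by simp
  have x: "minor (Suc k) M f (h \<circ> skip m) = \<Phi> (h 0)"
    using insert[of 0 "h \<circ> skip m"] m by (cases m) (auto simp: W_def skip_def)
  have y: "minor (Suc k) M f (h \<circ> skip 0) = (-1) ^ (m - 1) * \<Phi> (h m)"
    using insert[of "m - 1" "h \<circ> skip 0"] m by (simp add: W_def skip_def)
  have "W k = h (k + 2)" using m by (auto simp: W_def skip_def)
  then have z: "minor (Suc k) M f W = (-1) ^ k * \<Phi> (h (k + 2))"
    using insert[of k W] by (simp add: skip_def)
  have D: "minor (k + 2) M f h = D (k + 2)"
    unfolding D_def by (rule minor_cong) (simp add: skip_def)
  have sign: "(-1) ^ m = - ((-1 :: real) ^ (m - 1))"
    using m by (cases m) auto
  have "D m * ((-1) ^ (m - 1) * \<Phi> (h m)) = D 0 * \<Phi> (h 0) + D (k + 2) * ((-1) ^ k * \<Phi> (h (k + 2)))"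
    using rel unfolding sign by (simp only: mult_ac minus_mult_left[symmetric])
  then show ?thesis
    unfolding D x y W_def[symmetric] z by (simp only: D_def)
qed

text \<open>A column set with a gap is resolved by inserting the column after the gap's left end: the three-term
  relation then expresses its minor through minors of smaller spread.\<close>

lemma fekete_columns:
  fixes S :: "real set"
  assumes S: "\<And>x y a b c z. x \<in> S \<Longrightarrow> y \<in> S \<Longrightarrow> a > 0 \<Longrightarrow> b > 0 \<Longrightarrow> c > 0 \<Longrightarrow> z * c = x * a + y * b \<Longrightarrow> z \<in> S"
    and lower: "\<And>g. g \<in> idx k n \<Longrightarrow> minor k M f g > 0"
    and solid: "\<And>q. q + Suc k \<le> n \<Longrightarrow> minor (Suc k) M f (\<lambda>a. q + a) \<in> S"
    and g: "g \<in> idx (Suc k) n"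
  shows "minor (Suc k) M f g \<in> S"
  using g
proof (induction "g k - g 0" arbitrary: g rule: less_induct)
  case less
  show ?case
  proof (cases "\<exists>a<k. Suc (g a) \<noteq> g (Suc a)")
    case False
    have eq: "g a = g 0 + a" if "a < Suc k" for a
      using that
    proof (induction a)
      case (Suc a)
      then have "g (Suc a) = Suc (g a)" using False by auto
      then show ?case using Suc by simp
    qed simp
    have "minor (Suc k) M f g = minor (Suc k) M f (\<lambda>a. g 0 + a)"
      by (intro minor_cong arg_cong[OF eq])
    moreover have "g 0 + Suc k \<le> n"
      using idx_lower[OF less.prems, of 0 k] idx_bound[OF less.prems, of k] by simp
    ultimately show ?thesis using solid by simp
  next
    case True
    then obtain a where a: "a < k" "Suc (g a) \<noteq> g (Suc a)" by blast
    then have gap: "Suc (g a) < g (Suc a)" using idx_mono[OF less.prems, of a "Suc a"] by simp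
    obtain l where k: "k = Suc l" using a by (cases k) auto
    define h where "h q = (if q \<le> a then g q else if q = Suc a then Suc (g a) else g (q - 1))" for q
    have h: "h \<in> idx (k + 2) n"
    proof (rule idx_sucI)
      fix q assume "Suc q < k + 2"
      then show "h q < h (Suc q)"
        using gap a idx_mono[OF less.prems, of q "Suc q"] idx_mono[OF less.prems, of "q - 1" q]
        unfolding h_def by (auto simp: not_le)
    next
      fix q assume "q < k + 2"
      then show "h q < n"
        using gap a idx_bound[OF less.prems, of q] idx_bound[OF less.prems, of "q - 1"]
          idx_bound[OF less.prems, of "Suc a"] unfolding h_def by auto
    qed
    have hg: "minor (Suc k) M f (h \<circ> skip (Suc a)) = minor (Suc k) M f g"
      by (rule minor_cong) (auto simp: h_def skip_def)
    have h': "h \<in> idx (Suc (Suc k)) n" using h by simp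
    have i0: "h \<circ> skip 0 \<in> idx (Suc k) n" by (rule idx_skip[OF h'])
    have i1: "h \<in> idx (Suc k) n" by (rule idx_restrict[OF h]) simp
    have end0: "h 0 = g 0" "h (Suc k) = g k" using a by (auto simp: h_def)
    \<comment> \<open>\<open>h\<close> has the ends of \<open>g\<close> and one column more, so
      dropping either end column lowers the spread on which the induction runs.\<close>
    have "(h \<circ> skip 0) k - (h \<circ> skip 0) 0 < g k - g 0"
      using idx_mono[OF h, of 0 1] idx_mono[OF h, of 1 "Suc k"] end0 a by (simp add: skip_def)
    then have S0: "minor (Suc k) M f (h \<circ> skip 0) \<in> S"
      using less.hyps i0 by blast
    have "h k - h 0 < g k - g 0"
      using idx_mono[OF h, of k "Suc k"] idx_mono[OF h, of 0 k] end0 a by simp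
    then have S1: "minor (Suc k) M f h \<in> S"
      using less.hyps i1 by blast
    have "minor k M f (h \<circ> skip (Suc a)) > 0" "minor k M f (h \<circ> skip 0) > 0"
      "minor k M f (h \<circ> skip 0 \<circ> skip a) > 0"
      using idx_skip[OF h'] idx_restrict[of _ "Suc k" n k] idx_skip[OF idx_skip[OF h']] lower by auto
    then show ?thesis
      using S[OF S0 S1, of "minor k M f (h \<circ> skip (Suc a))" "minor k M f (h \<circ> skip 0 \<circ> skip a)"
          "minor k M f (h \<circ> skip 0)" "minor (Suc k) M f g"]
        minor_three_term[of "Suc a" l M f h] hg a k by simp
  qed
qed

text \<open>\<open>S\<close> is either the positive numbers or \<open>{0}\<close>, so that
  positivity and vanishing share one argument. \<open>fekete_columns\<close> is used twice: on the
  transposed matrix it frees the rows while the columns stay consecutive, and then it frees the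
  columns.\<close>

lemma fekete_step:
  fixes S :: "real set"
  assumes S: "S = {0<..} \<or> S = {0}"
    and lower: "\<And>f g. f \<in> idx k m \<Longrightarrow> g \<in> idx k n \<Longrightarrow> minor k M f g > 0"
    and solid: "\<And>p q. p + Suc k \<le> m \<Longrightarrow> q + Suc k \<le> n \<Longrightarrow>
      minor (Suc k) M (\<lambda>a. p + a) (\<lambda>a. q + a) \<in> S"
    and fg: "f \<in> idx (Suc k) m" "g \<in> idx (Suc k) n"
  shows "minor (Suc k) M f g \<in> S"
proof -
  have closed: "z \<in> S" if "x \<in> S" "y \<in> S" "a > 0" "b > 0" "c > 0" "z * c = x * a + y * b" for x y z a b c :: real
    using S
  proof
    assume "S = {0<..}"
    then have "z * c > 0" using that by (simp add: add_pos_pos)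
    then show ?thesis using that(5) \<open>S = {0<..}\<close> by (simp add: zero_less_mult_iff)
  next
    assume "S = {0}"
    then show ?thesis using that by simp
  qed
  have "minor (Suc k) M f (\<lambda>a. q + a) \<in> S" if q: "q + Suc k \<le> n" for q
    unfolding minor_transpose[of _ M]
  proof (rule fekete_columns[where n = m and k = k])
    fix f assume f: "f \<in> idx k m"
    show "minor k (\<lambda>p q. M q p) (\<lambda>a. q + a) f > 0"
      unfolding minor_transpose[of k M, symmetric]
      by (rule lower[OF f]) (use q in \<open>auto intro!: idxI\<close>)
  next
    fix p assume "p + Suc k \<le> m"
    then show "minor (Suc k) (\<lambda>p q. M q p) (\<lambda>a. q + a) (\<lambda>a. p + a) \<in> S"
      unfolding minor_transpose[of _ M, symmetric] using solid q by simp
  qed (use closed fg in blast)+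
  moreover have "minor k M f g > 0" if "g \<in> idx k n" for g
    using lower idx_restrict[OF fg(1), of k] that by simp
  ultimately show ?thesis
    using fekete_columns[of S k n M f g] closed fg(2) by blast
qed

lemma fekete:
  assumes solid: "\<And>k p q. k \<le> r \<Longrightarrow> p + k \<le> m \<Longrightarrow> q + k \<le> n \<Longrightarrow>
      minor k M (\<lambda>a. p + a) (\<lambda>a. q + a) > 0"
    and "k \<le> r" "f \<in> idx k m" "g \<in> idx k n"
  shows "minor k M f g > 0"
  using assms(2-)
proof (induction k arbitrary: f g)
  case (Suc k)
  have "minor (Suc k) M f g \<in> {0<..}"
  proof (rule fekete_step[OF _ _ _ Suc.prems(2,3)])
    fix f g assume "f \<in> idx k m" "g \<in> idx k n"
    then show "minor k M f g > 0" using Suc.IH Suc.prems(1) Suc_leD by blast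
  next
    fix p q assume "p + Suc k \<le> m" "q + Suc k \<le> n"
    then show "minor (Suc k) M (\<lambda>a. p + a) (\<lambda>a. q + a) \<in> {0<..}"
      using solid[OF Suc.prems(1)] by simp
  qed simp
  then show ?case by simp
qed simp

text \<open>One size beyond the positive range: the positive minors of size \<open>r\<close> are the
  coefficients of the three-term relation, which spreads the vanishing of the consecutive minors to
  all.\<close>

lemma fekete_zero:
  assumes solid: "\<And>k p q. k \<le> r \<Longrightarrow> p + k \<le> m \<Longrightarrow> q + k \<le> n \<Longrightarrow>
      minor k M (\<lambda>a. p + a) (\<lambda>a. q + a) > 0"
    and zero: "\<And>p q. p + Suc r \<le> m \<Longrightarrow> q + Suc r \<le> n \<Longrightarrow>
      minor (Suc r) M (\<lambda>a. p + a) (\<lambda>a. q + a) = 0"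
    and "f \<in> idx (Suc r) m" "g \<in> idx (Suc r) n"
  shows "minor (Suc r) M f g = 0"
proof -
  have "minor (Suc r) M f g \<in> {0}"
  proof (rule fekete_step[OF _ _ _ assms(3,4)])
    fix f g assume "f \<in> idx r m" "g \<in> idx r n"
    then show "minor r M f g > 0" using fekete[where r = r and k = r and m = m and n = n, OF solid] by blast
  next
    fix p q assume "p + Suc r \<le> m" "q + Suc r \<le> n"
    then show "minor (Suc r) M (\<lambda>a. p + a) (\<lambda>a. q + a) \<in> {0}"
      using zero by simp
  qed simp
  then show ?thesis by simp
qed

text \<open>Right multiplication by a bidiagonal matrix: the effect on a Toeplitz matrix of differentiating
  along \<open>ax + by\<close>.\<close>

definition bidiag :: "real \<Rightarrow> real \<Rightarrow> (nat \<Rightarrow> nat \<Rightarrow> real) \<Rightarrow> nat \<Rightarrow> nat \<Rightarrow> real" where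
  "bidiag a b M p q = a * M p (Suc q) + b * M p q"

definition bidiag_coeff :: "real \<Rightarrow> real \<Rightarrow> nat \<Rightarrow> nat \<Rightarrow> real" where
  "bidiag_coeff a b s q = (if s = q then b else if s = Suc q then a else 0)"

lemma minor_bidiag:
  assumes "g \<in> idx k n"
  shows "minor k (bidiag a b M) f g =
    (\<Sum>h\<in>PiE {..<k} (\<lambda>_. {..n}). (\<Prod>c<k. bidiag_coeff a b (h c) (g c)) * minor k M f h)"
proof -
  have "minor k (bidiag a b M) f g =
      minor k (\<lambda>p q. \<Sum>s\<le>n. M p s * bidiag_coeff a b s q) f g"
  proof (rule minor_cong)
    fix c e assume "e < k"
    then have "g e < n" using assms idx_bound by blast
    then have "(\<Sum>s\<le>n. M (f c) s * bidiag_coeff a b s (g e)) =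
        (\<Sum>s\<in>{g e, Suc (g e)}. M (f c) s * bidiag_coeff a b s (g e))"
      by (intro sum.mono_neutral_right) (auto simp: bidiag_coeff_def)
    then show "bidiag a b M (f c) (g e) = (\<Sum>s\<le>n. M (f c) s * bidiag_coeff a b s (g e))"
      by (simp add: bidiag_def bidiag_coeff_def)
  qed
  then show ?thesis by (simp add: minor_expand)
qed

text \<open>A nonzero product forces each \<open>h c\<close> to be \<open>g c\<close> or
  \<open>Suc (g c)\<close>, so \<open>h\<close> is weakly increasing because \<open>g\<close> is
  strictly increasing. A tie then repeats a column. Hence only minors on genuine column sets survive
  in the expansion.\<close>

lemma bidiag_choice:
  assumes "g \<in> idx k n" "h \<in> PiE {..<k} (\<lambda>_. {..n})"
  shows "(\<Prod>c<k. bidiag_coeff a b (h c) (g c)) = 0 \<or> minor k M f h = 0 \<or> h \<in> idx k (Suc n)"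
proof (rule ccontr)
  assume contr: "\<not> ?thesis"
  then have nz: "minor k M f h \<noteq> 0" by simp
  from contr have "h \<notin> idx k (Suc n)" by simp
  moreover have "h c < Suc n" if "c < k" for c using PiE_mem[OF assms(2), of c] that by simp
  ultimately obtain c where c: "Suc c < k" "\<not> h c < h (Suc c)" using idx_sucI by blast
  then have "h c \<noteq> h (Suc c)" using minor_repeated_col[of c k "Suc c" h M f] nz by auto
  then have "h (Suc c) < h c" using c by simp
  moreover have "g c < g (Suc c)" using assms(1) c idx_mono by blast
  ultimately have "bidiag_coeff a b (h c) (g c) = 0 \<or> bidiag_coeff a b (h (Suc c)) (g (Suc c)) = 0"
    by (auto simp: bidiag_coeff_def)
  then have "(\<Prod>c<k. bidiag_coeff a b (h c) (g c)) = 0"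
    using c by (auto simp: prod_zero_iff dest: Suc_lessD)
  then show False using contr by simp
qed

lemma minor_bidiag_zero:
  assumes "\<And>h. h \<in> idx k (Suc n) \<Longrightarrow> minor k M f h = 0" "g \<in> idx k n"
  shows "minor k (bidiag a b M) f g = 0"
  unfolding minor_bidiag[OF assms(2)]
proof (intro sum.neutral ballI)
  fix h assume "h \<in> PiE {..<k} (\<lambda>_. {..n})"
  then show "(\<Prod>c<k. bidiag_coeff a b (h c) (g c)) * minor k M f h = 0"
    using bidiag_choice[OF assms(2), of h a b M f] assms(1)[of h] by (metis mult_zero_left mult_zero_right)
qed

lemma bidiag_term_nonneg:
  assumes "\<And>h. h \<in> idx k (Suc n) \<Longrightarrow> minor k M f h \<ge> 0" "g \<in> idx k n" "a \<ge> 0" "b \<ge> 0"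
    "h \<in> PiE {..<k} (\<lambda>_. {..n})"
  shows "(\<Prod>c<k. bidiag_coeff a b (h c) (g c)) * minor k M f h \<ge> 0"
proof -
  have "(\<Prod>c<k. bidiag_coeff a b (h c) (g c)) \<ge> 0"
    by (rule prod_nonneg) (use assms in \<open>auto simp: bidiag_coeff_def\<close>)
  moreover have "(\<Prod>c<k. bidiag_coeff a b (h c) (g c)) = 0 \<or> minor k M f h \<ge> 0"
    using bidiag_choice[OF assms(2,5), of a b M f] assms(1)[of h] by (metis order_refl)
  ultimately show ?thesis by (metis mult_nonneg_nonneg mult_zero_left order_refl)
qed

lemma minor_bidiag_nonneg:
  assumes "\<And>h. h \<in> idx k (Suc n) \<Longrightarrow> minor k M f h \<ge> 0" "g \<in> idx k n" "a \<ge> 0" "b \<ge> 0"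
  shows "minor k (bidiag a b M) f g \<ge> 0"
  unfolding minor_bidiag[OF assms(2)] by (rule sum_nonneg[OF bidiag_term_nonneg[OF assms]])

text \<open>All terms of the expansion are nonnegative, so it is enough to find \<open>g\<close> for
  which \<open>h\<close> contributes a positive one. Columns of \<open>h\<close> from its first gap
  on are lowered by one, with weight \<open>a\<close>; those before it stay, with weight
  \<open>b\<close>.\<close>

lemma minor_bidiag_pos:
  assumes nonneg: "\<And>h. h \<in> idx k (Suc n) \<Longrightarrow> minor k M f h \<ge> 0"
    and h: "h \<in> idx k (Suc n)" "minor k M f h > 0" and ab: "a > 0" "b > 0" and "k \<le> n"
  shows "\<exists>g\<in>idx k n. minor k (bidiag a b M) f g > 0"
proof -
  \<comment> \<open>\<open>s\<close> is the length of the initial run \<open>h c = c\<close>, which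
    cannot be lowered. From \<open>s\<close> on \<open>c < h c\<close>, so lowering keeps the map
    increasing and avoids column \<open>n\<close>.\<close>
  have "\<exists>s\<le>k. (\<forall>c<s. h c = c) \<and> (\<forall>c. s \<le> c \<and> c < k \<longrightarrow> c < h c)"
  proof (cases "\<exists>c<k. h c \<noteq> c")
    case True
    define s where "s = (LEAST c. c < k \<and> h c \<noteq> c)"
    have s: "s < k" "h s \<noteq> s" "\<forall>c<s. h c = c"
    proof -
      show "s < k" "h s \<noteq> s"
        using LeastI_ex[of "\<lambda>c. c < k \<and> h c \<noteq> c"] True unfolding s_def by blast+
      then show "\<forall>c<s. h c = c"
        using not_less_Least[of _ "\<lambda>c. c < k \<and> h c \<noteq> c"] less_trans unfolding s_def by blast
    qed
    have "s < h s" using idx_lower[OF h(1), of 0 s] s by simp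
    then have "c < h c" if "s \<le> c" "c < k" for c
      using idx_lower[OF h(1) that] that by linarith
    then show ?thesis using s less_imp_le by blast
  next
    case False
    then show ?thesis by (intro exI[of _ k]) auto
  qed
  then obtain s where s: "s \<le> k" "\<And>c. c < s \<Longrightarrow> h c = c" "\<And>c. s \<le> c \<Longrightarrow> c < k \<Longrightarrow> c < h c" by blast
  define g where "g c = (if c < s then h c else h c - 1)" for c
  have g: "g \<in> idx k n"
  proof (rule idx_sucI)
    fix c assume c: "Suc c < k"
    then show "g c < g (Suc c)"
      using s(3)[of c] s(3)[of "Suc c"] s(2)[of c] idx_mono[OF h(1), of c "Suc c"] c unfolding g_def by auto
  next
    fix c assume c: "c < k"
    then show "g c < n"
      using s(2)[of c] s(3)[of c] idx_bound[OF h(1), of c] \<open>k \<le> n\<close> unfolding g_def by auto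
  qed
  \<comment> \<open>The restriction only places \<open>h\<close> in the range of summation; the
    minor does not see it.\<close>
  let ?h = "\<lambda>c\<in>{..<k}. h c"
  have hP: "?h \<in> PiE {..<k} (\<lambda>_. {..n})" using idx_bound[OF h(1)] by (auto simp: less_Suc_eq_le)
  have "(\<Prod>c<k. bidiag_coeff a b (?h c) (g c)) > 0"
  proof (rule prod_pos)
    fix c assume "c \<in> {..<k}"
    then show "bidiag_coeff a b (?h c) (g c) > 0"
      using s(3)[of c] ab unfolding bidiag_coeff_def g_def by auto
  qed
  moreover have "minor k M f ?h = minor k M f h" by (rule minor_cong) simp
  ultimately have "(\<Prod>c<k. bidiag_coeff a b (?h c) (g c)) * minor k M f ?h > 0" using h(2) by simp
  then have "minor k (bidiag a b M) f g > 0"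
    unfolding minor_bidiag[OF g] using bidiag_term_nonneg[OF nonneg g] ab
    by (intro sum_pos2[OF _ hP]) (auto intro!: finite_PiE)
  then show ?thesis using g by blast
qed

section \<open>Gram determinants of the moment functional\<close>

definition moment :: "(nat \<Rightarrow> real) \<Rightarrow> real poly \<Rightarrow> real" where
  "moment c p = (\<Sum>n\<le>degree p. coeff p n * c n)"

lemma moment_bound: "degree p \<le> N \<Longrightarrow> moment c p = (\<Sum>n\<le>N. coeff p n * c n)"
  unfolding moment_def by (rule sum.mono_neutral_left) (auto simp: coeff_eq_0)

lemma moment_0 [simp]: "moment c 0 = 0"
  by (simp add: moment_def)

lemma moment_add: "moment c (p + q) = moment c p + moment c q"
  using moment_bound[of "p + q" "max (degree p) (degree q)"] moment_bound[of p "max (degree p) (degree q)"]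
    moment_bound[of q "max (degree p) (degree q)"] degree_add_le_max[of p q]
  by (simp add: algebra_simps sum.distrib)

lemma moment_smult: "moment c (Polynomial.smult a p) = a * moment c p"
  using moment_bound[of "Polynomial.smult a p" "degree p"] by (simp add: moment_def sum_distrib_left mult_ac degree_smult_le)

lemma moment_minus: "moment c (- p) = - moment c p"
  using moment_smult[of c "-1" p] by simp

lemma moment_sum: "moment c (\<Sum>x\<in>A. f x) = (\<Sum>x\<in>A. moment c (f x))"
  by (induction A rule: infinite_finite_induct) (auto simp: moment_add)

lemma moment_monom [simp]: "moment c (monom a n) = a * c n"
  using moment_bound[of "monom a n" n c] by (simp add: degree_monom_le if_distrib[of "\<lambda>x. x * _"] cong: if_cong)

lemma monom_expand: "degree (p :: real poly) < n \<Longrightarrow> p = (\<Sum>s<n. Polynomial.smult (coeff p s) (monom 1 s))"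
  by (intro poly_eqI) (auto simp: coeff_sum if_distrib coeff_eq_0 cong: if_cong)

lemma monom_1_add: "monom (1 :: real) (a + b) = monom 1 a * monom 1 b"
  by (simp add: mult_monom)

lemma moment_mult_expand:
  assumes "degree p < n"
  shows "moment c (w * p) = (\<Sum>s<n. coeff p s * moment c (w * monom 1 s))"
proof -
  have "moment c (w * p) = moment c (w * (\<Sum>s<n. Polynomial.smult (coeff p s) (monom 1 s)))"
    using monom_expand[OF assms] by simp
  then show ?thesis by (simp add: sum_distrib_left moment_sum moment_smult)
qed

section \<open>Toeplitz matrices under multiplication by linear forms\<close>

lemma moment_linear: "moment c (w * [:b, a:] * monom 1 n) = a * moment c (w * monom 1 (Suc n)) + b * moment c (w * monom 1 n)"
proof -
  have "[:b, a:] * monom 1 n = Polynomial.smult a (monom 1 (Suc n)) + Polynomial.smult b (monom 1 n)"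
    by (simp add: monom_Suc)
  then have "w * [:b, a:] * monom 1 n = Polynomial.smult a (w * monom 1 (Suc n)) + Polynomial.smult b (w * monom 1 n)"
    unfolding mult.assoc by (simp add: distrib_left)
  then show ?thesis by (simp add: moment_add moment_smult)
qed

text \<open>If \<open>c\<close> holds the normalized coefficients of \<open>F\<close>, this is, up
  to a constant factor, the Toeplitz matrix of the derivative of \<open>F\<close> by the form that
  becomes \<open>w\<close> at \<open>y = 1\<close>. Truncated subtraction is harmless on rows
  \<open>p \<le> i\<close>.\<close>

definition toeplitz_entry :: "(nat \<Rightarrow> real) \<Rightarrow> real poly \<Rightarrow> nat \<Rightarrow> nat \<Rightarrow> nat \<Rightarrow> real" where
  "toeplitz_entry c w i p q = moment c (w * monom 1 (i + q - p))"

lemma toeplitz_entry_1: "toeplitz_entry c 1 i p q = c (i + q - p)"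
  by (simp add: toeplitz_entry_def)

lemma toeplitz_entry_linear_col: "p \<le> i \<Longrightarrow> toeplitz_entry c (w * [:b, a:]) i p q = bidiag a b (toeplitz_entry c w i) p q"
  unfolding toeplitz_entry_def moment_linear bidiag_def by (simp add: Suc_diff_le)

text \<open>The same derivative can shorten the matrix by a row instead of a column. The weights
  change places because a larger row index means a smaller power of \<open>t\<close>.\<close>

lemma toeplitz_entry_linear_row:
  "p \<le> i \<Longrightarrow> toeplitz_entry c (w * [:b, a:]) i p q = bidiag b a (\<lambda>q p. toeplitz_entry c w (Suc i) p q) q p"
  unfolding toeplitz_entry_def moment_linear bidiag_def by (simp add: Suc_diff_le)

text \<open>For a totally nonnegative matrix this says that the rank is at least \<open>k\<close>,
  and \<open>minors_zero\<close> that it is below \<open>k\<close>. Only the existence of a positive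
  minor is recorded, since a bidiagonal factor may change which columns carry it.\<close>

definition minors_pos :: "nat \<Rightarrow> (nat \<Rightarrow> nat \<Rightarrow> real) \<Rightarrow> nat \<Rightarrow> nat \<Rightarrow> bool" where
  "minors_pos k M m n \<longleftrightarrow> (\<forall>f\<in>idx k m. \<forall>g\<in>idx k n. minor k M f g \<ge> 0) \<and>
     (\<exists>f\<in>idx k m. \<exists>g\<in>idx k n. minor k M f g > 0)"

definition minors_zero :: "nat \<Rightarrow> (nat \<Rightarrow> nat \<Rightarrow> real) \<Rightarrow> nat \<Rightarrow> nat \<Rightarrow> bool" where
  "minors_zero k M m n \<longleftrightarrow> (\<forall>f\<in>idx k m. \<forall>g\<in>idx k n. minor k M f g = 0)"

lemma minors_transpose:
  "minors_pos k M m n \<longleftrightarrow> minors_pos k (\<lambda>q p. M p q) n m"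
  "minors_zero k M m n \<longleftrightarrow> minors_zero k (\<lambda>q p. M p q) n m"
  unfolding minors_pos_def minors_zero_def minor_transpose[of k M] by blast+

lemma minors_cong:
  assumes "\<And>p q. p < m \<Longrightarrow> q < n \<Longrightarrow> M p q = M' p q"
  shows "minors_pos k M m n \<longleftrightarrow> minors_pos k M' m n" "minors_zero k M m n \<longleftrightarrow> minors_zero k M' m n"
proof -
  have "minor k M f g = minor k M' f g" if "f \<in> idx k m" "g \<in> idx k n" for f g
    by (rule minor_cong) (use assms that idx_bound in blast)
  then show "minors_pos k M m n \<longleftrightarrow> minors_pos k M' m n" "minors_zero k M m n \<longleftrightarrow> minors_zero k M' m n"
    unfolding minors_pos_def minors_zero_def by simp_all
qed

lemma minors_bidiag:
  assumes "a > 0" "b > 0" "k \<le> n"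
  shows "minors_pos k M m (Suc n) \<Longrightarrow> minors_pos k (bidiag a b M) m n"
    "minors_zero k M m (Suc n) \<Longrightarrow> minors_zero k (bidiag a b M) m n"
proof -
  assume M: "minors_pos k M m (Suc n)"
  then obtain f h where fh: "f \<in> idx k m" "h \<in> idx k (Suc n)" "minor k M f h > 0"
    unfolding minors_pos_def by blast
  have nonneg: "minor k M f h \<ge> 0" if "f \<in> idx k m" "h \<in> idx k (Suc n)" for f h
    using M that unfolding minors_pos_def by blast
  have "minor k (bidiag a b M) f g \<ge> 0" if "f \<in> idx k m" "g \<in> idx k n" for f g
    using minor_bidiag_nonneg[of k n M f g a b] nonneg that assms by simp
  moreover have "\<exists>g\<in>idx k n. minor k (bidiag a b M) f g > 0"
    using minor_bidiag_pos[of k n M f h a b] nonneg fh assms by simp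
  ultimately show "minors_pos k (bidiag a b M) m n"
    unfolding minors_pos_def using fh(1) by blast
next
  assume "minors_zero k M m (Suc n)"
  then show "minors_zero k (bidiag a b M) m n"
    unfolding minors_zero_def using minor_bidiag_zero by blast
qed

lemma minors_toeplitz_entry_col:
  assumes "a > 0" "b > 0" "k \<le> n"
  shows "minors_pos k (toeplitz_entry c w i) (Suc i) (Suc n) \<Longrightarrow> minors_pos k (toeplitz_entry c (w * [:b, a:]) i) (Suc i) n"
    "minors_zero k (toeplitz_entry c w i) (Suc i) (Suc n) \<Longrightarrow> minors_zero k (toeplitz_entry c (w * [:b, a:]) i) (Suc i) n"
proof -
  have "minors_pos k (toeplitz_entry c (w * [:b, a:]) i) (Suc i) n \<longleftrightarrow> minors_pos k (bidiag a b (toeplitz_entry c w i)) (Suc i) n"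
    "minors_zero k (toeplitz_entry c (w * [:b, a:]) i) (Suc i) n \<longleftrightarrow> minors_zero k (bidiag a b (toeplitz_entry c w i)) (Suc i) n"
    by (rule minors_cong; rule toeplitz_entry_linear_col, simp)+
  then show "minors_pos k (toeplitz_entry c w i) (Suc i) (Suc n) \<Longrightarrow> minors_pos k (toeplitz_entry c (w * [:b, a:]) i) (Suc i) n"
    "minors_zero k (toeplitz_entry c w i) (Suc i) (Suc n) \<Longrightarrow> minors_zero k (toeplitz_entry c (w * [:b, a:]) i) (Suc i) n"
    using minors_bidiag[OF assms] by blast+
qed

lemma minors_toeplitz_entry_row:
  assumes "a > 0" "b > 0" "k \<le> Suc i"
  shows "minors_pos k (toeplitz_entry c w (Suc i)) (Suc (Suc i)) n \<Longrightarrow> minors_pos k (toeplitz_entry c (w * [:b, a:]) i) (Suc i) n"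
    "minors_zero k (toeplitz_entry c w (Suc i)) (Suc (Suc i)) n \<Longrightarrow> minors_zero k (toeplitz_entry c (w * [:b, a:]) i) (Suc i) n"
proof -
  let ?M = "\<lambda>q p. toeplitz_entry c w (Suc i) p q"
  have "minors_pos k (\<lambda>q p. toeplitz_entry c (w * [:b, a:]) i p q) n (Suc i) \<longleftrightarrow> minors_pos k (bidiag b a ?M) n (Suc i)"
    "minors_zero k (\<lambda>q p. toeplitz_entry c (w * [:b, a:]) i p q) n (Suc i) \<longleftrightarrow> minors_zero k (bidiag b a ?M) n (Suc i)"
    by (rule minors_cong; rule toeplitz_entry_linear_row, simp)+
  then show "minors_pos k (toeplitz_entry c w (Suc i)) (Suc (Suc i)) n \<Longrightarrow> minors_pos k (toeplitz_entry c (w * [:b, a:]) i) (Suc i) n"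
    "minors_zero k (toeplitz_entry c w (Suc i)) (Suc (Suc i)) n \<Longrightarrow> minors_zero k (toeplitz_entry c (w * [:b, a:]) i) (Suc i) n"
    unfolding minors_transpose[of k _ "Suc i"] minors_transpose[of k _ "Suc (Suc i)"]
    using minors_bidiag[OF assms(2,1,3)] by blast+
qed

definition pos_lin :: "real poly set" where
  "pos_lin = {[:b, a:] | a b. a > 0 \<and> b > 0}"

definition toeplitz_det :: "(nat \<Rightarrow> real) \<Rightarrow> nat \<Rightarrow> real poly \<Rightarrow> real" where
  "toeplitz_det c k w = minor k (toeplitz_entry c w (k - 1)) id id"

lemma minors_square:
  "minors_pos k M k k \<longleftrightarrow> minor k M id id > 0" "minors_zero k M k k \<longleftrightarrow> minor k M id id = 0"
proof -
  have id: "id \<in> idx k k" by (auto intro: idxI)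
  have eq: "minor k M f g = minor k M id id" if "f \<in> idx k k" "g \<in> idx k k" for f g
    by (rule minor_cong) (simp add: idx_self[OF that(1)] idx_self[OF that(2)])
  have all: "(\<forall>f\<in>idx k k. \<forall>g\<in>idx k k. P (minor k M f g)) \<longleftrightarrow> P (minor k M id id)"
    and ex: "(\<exists>f\<in>idx k k. \<exists>g\<in>idx k k. P (minor k M f g)) \<longleftrightarrow> P (minor k M id id)" for P
    using eq id by metis+
  show "minors_pos k M k k \<longleftrightarrow> minor k M id id > 0" "minors_zero k M k k \<longleftrightarrow> minor k M id id = 0"
    unfolding minors_pos_def minors_zero_def
    using all[of "\<lambda>x. x \<ge> 0"] all[of "\<lambda>x. x = 0"] ex[of "\<lambda>x. x > 0"] by linarith+
qed

text \<open>Each linear factor in \<open>ls\<close> removes a column while more than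
  \<open>k\<close> columns are left, and a row afterwards. The length condition makes
  \<open>ls\<close> run out exactly when the matrix is \<open>k\<close> by \<open>k\<close>, where
  the determinant is the only minor of that size.\<close>

lemma toeplitz_det_prod:
  assumes "set ls \<subseteq> pos_lin" "length ls + 2 * k = Suc i + n" "0 < k" "k \<le> Suc i" "k \<le> n"
  shows "minors_pos k (toeplitz_entry c w i) (Suc i) n \<Longrightarrow> toeplitz_det c k (w * prod_list ls) > 0"
    "minors_zero k (toeplitz_entry c w i) (Suc i) n \<Longrightarrow> toeplitz_det c k (w * prod_list ls) = 0"
proof -
  have "(minors_pos k (toeplitz_entry c w i) (Suc i) n \<longrightarrow> toeplitz_det c k (w * prod_list ls) > 0) \<and>
    (minors_zero k (toeplitz_entry c w i) (Suc i) n \<longrightarrow> toeplitz_det c k (w * prod_list ls) = 0)"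
    using assms
  proof (induction ls arbitrary: w i n)
    case Nil
    then have "n = k" "Suc i = k" by auto
    moreover from this have "i = k - 1" by simp
    ultimately show ?case using minors_square by (simp add: toeplitz_det_def)
  next
    case (Cons l ls)
    then obtain a b where l: "l = [:b, a:]" "a > 0" "b > 0" unfolding pos_lin_def by auto
    show ?case
    proof (cases "k < n")
      case True
      then obtain n' where n: "n = Suc n'" "k \<le> n'" by (cases n) auto
      have "(minors_pos k (toeplitz_entry c (w * l) i) (Suc i) n' \<longrightarrow> toeplitz_det c k (w * l * prod_list ls) > 0) \<and>
        (minors_zero k (toeplitz_entry c (w * l) i) (Suc i) n' \<longrightarrow> toeplitz_det c k (w * l * prod_list ls) = 0)"
        by (rule Cons.IH) (use Cons.prems n in auto)
      then show ?thesis
        using minors_toeplitz_entry_col[OF l(2,3) n(2), of c w i] unfolding n l prod_list.Cons mult.assoc[symmetric] by blast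
    next
      case False
      then obtain i' where i: "i = Suc i'" "k \<le> Suc i'" using Cons.prems by (cases i) auto
      have "(minors_pos k (toeplitz_entry c (w * l) i') (Suc i') n \<longrightarrow> toeplitz_det c k (w * l * prod_list ls) > 0) \<and>
        (minors_zero k (toeplitz_entry c (w * l) i') (Suc i') n \<longrightarrow> toeplitz_det c k (w * l * prod_list ls) = 0)"
        by (rule Cons.IH) (use Cons.prems i in auto)
      then show ?thesis
        using minors_toeplitz_entry_row[OF l(2,3) i(2), of c w n] unfolding i l prod_list.Cons mult.assoc[symmetric] by blast
    qed
  qed
  then show "minors_pos k (toeplitz_entry c w i) (Suc i) n \<Longrightarrow> toeplitz_det c k (w * prod_list ls) > 0"
    "minors_zero k (toeplitz_entry c w i) (Suc i) n \<Longrightarrow> toeplitz_det c k (w * prod_list ls) = 0" by auto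
qed

section \<open>Hankel and Gram determinants\<close>

lemma minor_mult:
  "minor k (\<lambda>p q. \<Sum>s<k. A p s * B s q) id id = minor k A id id * minor k B id id"
proof -
  have "mat k k (\<lambda>(a, b). \<Sum>s<k. A a s * B s b) = mat k k (\<lambda>(a, b). A a b) * mat k k (\<lambda>(a, b). B a b)"
    by (rule eq_matI) (auto simp: scalar_prod_def atLeast0LessThan)
  then show ?thesis
    unfolding minor_def by (simp add: det_mult[of _ k])
qed

lemma minor_left_kernel:
  "minor k M id id = 0 \<longleftrightarrow> (\<exists>v. (\<exists>p<k. v p \<noteq> 0) \<and> (\<forall>q<k. (\<Sum>p<k. v p * M p q) = 0))"
proof -
  let ?A = "mat k k (\<lambda>(a, b). M b a)"
  have mv: "(?A *\<^sub>v v) $ q = (\<Sum>p<k. v $ p * M p q)" if "v \<in> carrier_vec k" "q < k" for v q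
    using that by (auto simp: scalar_prod_def atLeast0LessThan mult_ac intro!: sum.cong)
  have "minor k M id id = det ?A"
    unfolding minor_transpose[of k M] by (simp add: minor_def)
  also have "\<dots> = 0 \<longleftrightarrow> (\<exists>v. v \<in> carrier_vec k \<and> v \<noteq> 0\<^sub>v k \<and> ?A *\<^sub>v v = 0\<^sub>v k)"
    by (rule det_0_iff_vec_prod_zero) simp
  also have "\<dots> \<longleftrightarrow> (\<exists>v. (\<exists>p<k. v p \<noteq> 0) \<and> (\<forall>q<k. (\<Sum>p<k. v p * M p q) = 0))"
  proof
    assume "\<exists>v. v \<in> carrier_vec k \<and> v \<noteq> 0\<^sub>v k \<and> ?A *\<^sub>v v = 0\<^sub>v k"
    then obtain v where v: "v \<in> carrier_vec k" "v \<noteq> 0\<^sub>v k" "?A *\<^sub>v v = 0\<^sub>v k" by blast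
    have "\<exists>p<k. v $ p \<noteq> 0" using v(1,2) by (metis carrier_vecD eq_vecI index_zero_vec)
    moreover have "\<forall>q<k. (\<Sum>p<k. v $ p * M p q) = 0" using mv[OF v(1)] v(3) by simp
    ultimately show "\<exists>v. (\<exists>p<k. v p \<noteq> 0) \<and> (\<forall>q<k. (\<Sum>p<k. v p * M p q) = 0)" by blast
  next
    assume "\<exists>v. (\<exists>p<k. v p \<noteq> 0) \<and> (\<forall>q<k. (\<Sum>p<k. v p * M p q) = 0)"
    then obtain v where v: "\<exists>p<k. v p \<noteq> 0" "\<forall>q<k. (\<Sum>p<k. v p * M p q) = 0" by blast
    let ?v = "vec k v"
    have "?A *\<^sub>v ?v = 0\<^sub>v k" by (rule eq_vecI) (use mv[of ?v] v(2) in auto)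
    moreover have "?v \<noteq> 0\<^sub>v k" using v(1) by (metis index_vec index_zero_vec(1))
    ultimately show "\<exists>v. v \<in> carrier_vec k \<and> v \<noteq> 0\<^sub>v k \<and> ?A *\<^sub>v v = 0\<^sub>v k"
      by (intro exI[of _ ?v]) simp
  qed
  finally show ?thesis .
qed

definition hankel_det :: "(nat \<Rightarrow> real) \<Rightarrow> nat \<Rightarrow> real poly \<Rightarrow> real" where
  "hankel_det c k w = minor k (\<lambda>p q. moment c (w * monom 1 (p + q))) id id"

definition coeff_det :: "nat \<Rightarrow> (nat \<Rightarrow> real poly) \<Rightarrow> real" where
  "coeff_det k e = minor k (\<lambda>p s. coeff (e p) s) id id"

text \<open>Expanding \<open>e p\<close> and \<open>f q\<close> in powers of \<open>t\<close> writes
  the Gram matrix as a product: coefficient matrix of \<open>e\<close>, Hankel matrix, transposed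
  coefficient matrix of \<open>f\<close>.\<close>

lemma gram_det:
  assumes "\<And>p. p < k \<Longrightarrow> degree (e p) < k" "\<And>q. q < k \<Longrightarrow> degree (f q) < k"
  shows "minor k (\<lambda>p q. moment c (w * e p * f q)) id id = coeff_det k e * hankel_det c k w * coeff_det k f"
proof -
  have "minor k (\<lambda>p q. moment c (w * e p * f q)) id id =
    minor k (\<lambda>p q. \<Sum>s<k. (\<Sum>u<k. coeff (e p) u * moment c (w * monom 1 (u + s))) * coeff (f q) s) id id"
  proof (rule minor_cong)
    fix p q assume pq: "p < k" "q < k"
    have "moment c (w * e p * f q) = (\<Sum>s<k. coeff (f q) s * moment c (w * e p * monom 1 s))"
      by (rule moment_mult_expand) (use assms pq in simp)
    also have "\<dots> = (\<Sum>s<k. coeff (f q) s * (\<Sum>u<k. coeff (e p) u * moment c (w * monom 1 s * monom 1 u)))"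
      using moment_mult_expand[OF assms(1), of p c "w * monom 1 _"] pq by (simp add: mult_ac)
    finally show "moment c (w * e (id p) * f (id q)) =
        (\<Sum>s<k. (\<Sum>u<k. coeff (e (id p)) u * moment c (w * monom 1 (u + s))) * coeff (f (id q)) s)"
      by (simp add: mult_monom mult_ac add_ac)
  qed
  also have "\<dots> = minor k (\<lambda>p q. \<Sum>s<k. coeff (e p) s * moment c (w * monom 1 (s + q))) id id *
      minor k (\<lambda>s q. coeff (f q) s) id id"
    by (rule minor_mult)
  finally show ?thesis
    unfolding minor_mult[where A = "\<lambda>p s. coeff (e p) s"]
    by (simp add: hankel_det_def coeff_det_def minor_transpose[of k "\<lambda>s q. coeff (f q) s"])
qed

text \<open>Toeplitz and Hankel matrices differ by reversing the rows; this is the sign of that permutation.\<close>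

definition reversal_sign :: "nat \<Rightarrow> real" where
  "reversal_sign k = coeff_det k (\<lambda>p. monom 1 (k - 1 - p))"

lemma coeff_det_monom: "coeff_det k (monom 1) = 1"
proof -
  have "mat k k (\<lambda>(a, b). coeff (monom (1 :: real) a) b) = 1\<^sub>m k"
    by (rule eq_matI) auto
  then show ?thesis by (simp add: coeff_det_def minor_def)
qed

lemma reversal_sign_square: "reversal_sign k * reversal_sign k = 1"
proof -
  have "reversal_sign k * reversal_sign k = coeff_det k (monom 1)"
    unfolding reversal_sign_def coeff_det_def minor_mult[symmetric]
  proof (rule minor_cong)
    fix p q assume pq: "p < k" "q < k"
    have "(\<Sum>s<k. coeff (monom 1 (k - 1 - id p)) s * coeff (monom 1 (k - 1 - s)) (id q))
        = (\<Sum>s<k. if s = k - 1 - p then coeff (monom (1 :: real) p) q else 0)"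
      using pq by (intro sum.cong) auto
    then show "(\<Sum>s<k. coeff (monom 1 (k - 1 - id p)) s * coeff (monom 1 (k - 1 - s)) (id q))
        = coeff (monom (1 :: real) (id p)) (id q)"
      using pq by simp
  qed
  then show ?thesis by (simp add: coeff_det_monom)
qed

lemma reversal_sign_Suc: "reversal_sign (Suc k) = (-1) ^ k * reversal_sign k"
proof -
  have "reversal_sign (Suc k) = (\<Sum>q\<le>k. (-1) ^ (q + 0) * coeff (monom 1 (Suc k - 1 - id 0)) (id q) *
      minor k (\<lambda>p s. coeff (monom 1 (Suc k - 1 - p)) s) (id \<circ> skip 0) (id \<circ> skip q))"
    unfolding reversal_sign_def coeff_det_def by (rule minor_laplace_row) simp
  also have "\<dots> = (\<Sum>q\<in>{k}. (-1) ^ (q + 0) * coeff (monom 1 (Suc k - 1 - id 0)) (id q) *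
      minor k (\<lambda>p s. coeff (monom 1 (Suc k - 1 - p)) s) (id \<circ> skip 0) (id \<circ> skip q))"
    by (rule sum.mono_neutral_right) auto
  also have "\<dots> = (-1) ^ k * minor k (\<lambda>p s. coeff (monom 1 (Suc k - 1 - p)) s) (id \<circ> skip 0) (id \<circ> skip k)"
    by simp
  also have "minor k (\<lambda>p s. coeff (monom 1 (Suc k - 1 - p)) s) (id \<circ> skip 0) (id \<circ> skip k) = reversal_sign k"
    unfolding reversal_sign_def coeff_det_def by (rule minor_cong) (simp add: skip_def)
  finally show ?thesis .
qed

lemma toeplitz_det_hdet: "toeplitz_det c k w = reversal_sign k * hankel_det c k w"
proof -
  have "toeplitz_det c k w = minor k (\<lambda>p q. moment c (w * monom 1 (k - 1 - p) * monom 1 q)) id id"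
    unfolding toeplitz_det_def by (rule minor_cong) (simp add: toeplitz_entry_def mult_monom mult.assoc)
  also have "\<dots> = coeff_det k (\<lambda>p. monom 1 (k - 1 - p)) * hankel_det c k w * coeff_det k (monom 1)"
    by (rule gram_det) (auto simp: degree_monom_eq)
  finally show ?thesis by (simp add: reversal_sign_def coeff_det_monom)
qed

lemma coeff_det_rev:
  assumes "\<And>p. p < k \<Longrightarrow> degree (e p) < k"
  shows "coeff_det k (\<lambda>p. e (k - 1 - p)) = reversal_sign k * coeff_det k e"
  unfolding coeff_det_def reversal_sign_def minor_mult[symmetric]
proof (rule minor_cong)
  fix p q assume pq: "p < k" "q < k"
  have "(\<Sum>s<k. coeff (monom 1 (k - 1 - p)) s * coeff (e s) q) = (\<Sum>s<k. if s = k - 1 - p then coeff (e s) q else 0)"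
    by (intro sum.cong) auto
  then show "coeff (e (k - 1 - id p)) (id q) = (\<Sum>s<k. coeff (monom 1 (k - 1 - id p)) s * coeff (e s) (id q))"
    using pq by simp
qed

lemma coeff_det_zero:
  assumes "coeff_det k e = 0" "\<And>p. p < k \<Longrightarrow> degree (e p) < k"
  shows "\<exists>v. (\<exists>p<k. v p \<noteq> 0) \<and> (\<Sum>p<k. Polynomial.smult (v p) (e p)) = 0"
proof -
  obtain v where v: "\<exists>p<k. v p \<noteq> 0" "\<forall>q<k. (\<Sum>p<k. v p * coeff (e p) q) = 0"
    using assms(1) unfolding coeff_det_def minor_left_kernel by blast
  have "(\<Sum>p<k. v p * coeff (e p) q) = 0" for q
  proof (cases "q < k")
    case False
    then have "coeff (e p) q = 0" if "p < k" for p
      using assms(2)[OF that] by (intro coeff_eq_0) simp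
    then show ?thesis by simp
  qed (use v in simp)
  then have "(\<Sum>p<k. Polynomial.smult (v p) (e p)) = 0" by (intro poly_eqI) (simp add: coeff_sum)
  then show ?thesis using v by blast
qed

text \<open>The Gram determinant in the basis \<open>l, l t, \<dots>, l t\<^sup>j\<^sup>-\<^sup>1, \<alpha>\<close> factors because \<open>\<alpha>\<close> is orthogonal
  to the multiples of \<open>l\<close>.\<close>

lemma primitive_sign:
  assumes pos: "toeplitz_det c (Suc j) w > 0" "toeplitz_det c j (w * l * l) > 0"
    and deg: "degree \<alpha> \<le> j" and "\<alpha> \<noteq> 0"
    and l: "degree l \<le> 1" "l \<noteq> 0"
    and prim: "\<And>b. b < j \<Longrightarrow> moment c (w * l * \<alpha> * monom 1 b) = 0"
  shows "(-1) ^ j * moment c (w * \<alpha> * \<alpha>) > 0"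
proof -
  define e where "e p = (if p < j then l * monom 1 p else \<alpha>)" for p
  let ?G = "\<lambda>p q. moment c (w * e p * e q)"
  have deg_e: "degree (e p) < Suc j" if "p < Suc j" for p
    using deg l degree_mult_le[of l "monom 1 p"] degree_monom_le[of "1 :: real" p] that by (auto simp: e_def)
  have off: "?G j q = 0" if "q < j" for q
    using prim[OF that] that by (simp add: e_def mult_ac)
  have "minor (Suc j) ?G id id =
      (\<Sum>q\<le>j. (-1) ^ (q + j) * ?G (id j) (id q) * minor j ?G (id \<circ> skip j) (id \<circ> skip q))"
    by (rule minor_laplace_row) simp
  also have "\<dots> = (\<Sum>q\<in>{j}. (-1) ^ (q + j) * ?G (id j) (id q) * minor j ?G (id \<circ> skip j) (id \<circ> skip q))"
    by (rule sum.mono_neutral_right) (use off in auto)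
  also have "\<dots> = moment c (w * \<alpha> * \<alpha>) * minor j ?G (id \<circ> skip j) (id \<circ> skip j)"
    by (simp add: e_def)
  also have "minor j ?G (id \<circ> skip j) (id \<circ> skip j) = hankel_det c j (w * l * l)"
    unfolding hankel_det_def by (rule minor_cong) (simp add: skip_def e_def monom_1_add mult_ac)
  finally have split: "minor (Suc j) ?G id id = moment c (w * \<alpha> * \<alpha>) * hankel_det c j (w * l * l)" .
  have h_nz: "hankel_det c j (w * l * l) \<noteq> 0" using pos(2) by (auto simp: toeplitz_det_hdet)
  \<comment> \<open>A dependence would make \<open>l * \<beta>\<close> a multiple of
    \<open>\<alpha>\<close>, hence orthogonal to \<open>l * monom 1 q\<close> for
    \<open>q < j\<close>. Since \<open>hankel_det c j (w * l * l)\<close> is nonzero,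
    \<open>\<beta> = 0\<close>, and then the coefficient of \<open>\<alpha>\<close> is zero as
    well.\<close>
  have "coeff_det (Suc j) e \<noteq> 0"
  proof
    assume "coeff_det (Suc j) e = 0"
    then obtain v where v: "\<exists>p<Suc j. v p \<noteq> 0" "(\<Sum>p<Suc j. Polynomial.smult (v p) (e p)) = 0"
      using coeff_det_zero[of "Suc j" e] deg_e by blast
    define \<beta> where "\<beta> = (\<Sum>p<j. Polynomial.smult (v p) (monom 1 p))"
    have "(\<Sum>p<j. Polynomial.smult (v p) (e p)) = l * \<beta>"
      unfolding \<beta>_def sum_distrib_left by (intro sum.cong) (auto simp: e_def)
    then have rel: "l * \<beta> + Polynomial.smult (v j) \<alpha> = 0" using v(2) by (simp add: e_def)
    have "\<forall>q<j. (\<Sum>p<j. v p * moment c (w * l * l * monom 1 (p + q))) = 0"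
    proof (intro allI impI)
      fix q assume q: "q < j"
      have "(\<Sum>p<j. v p * moment c (w * l * l * monom 1 (p + q))) = moment c (w * l * monom 1 q * (l * \<beta>))"
        unfolding \<beta>_def sum_distrib_left moment_sum
        by (intro sum.cong) (simp_all add: moment_smult monom_1_add mult_ac)
      also have "l * \<beta> = Polynomial.smult (- v j) \<alpha>" using rel by (simp add: eq_neg_iff_add_eq_0)
      finally show "(\<Sum>p<j. v p * moment c (w * l * l * monom 1 (p + q))) = 0"
        using prim[OF q] by (simp add: moment_smult moment_minus mult_ac)
    qed
    then have v0: "v p = 0" if "p < j" for p
      using h_nz that unfolding hankel_det_def minor_left_kernel by blast
    then have "\<beta> = 0" by (simp add: \<beta>_def)
    then have "v j = 0" using rel \<open>\<alpha> \<noteq> 0\<close> by simp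
    then show False using v0 v(1) less_Suc_eq by metis
  qed
  moreover have "minor (Suc j) ?G id id = coeff_det (Suc j) e * hankel_det c (Suc j) w * coeff_det (Suc j) e"
    by (rule gram_det) (use deg_e in auto)
  ultimately have "reversal_sign (Suc j) * (moment c (w * \<alpha> * \<alpha>) * hankel_det c j (w * l * l)) > 0"
    using pos(1) split by (metis mult.assoc mult.left_commute mult_pos_pos not_real_square_gt_zero toeplitz_det_hdet)
  moreover have "hankel_det c j (w * l * l) = reversal_sign j * toeplitz_det c j (w * l * l)"
    using reversal_sign_square[of j] by (simp add: toeplitz_det_hdet flip: mult.assoc)
  \<comment> \<open>The Hodge-Riemann sign is the quotient of the reversal signs of sizes
    \<open>j + 1\<close> and \<open>j\<close>.\<close>
  ultimately have "(reversal_sign j * reversal_sign j) * ((-1) ^ j * moment c (w * \<alpha> * \<alpha>) * toeplitz_det c j (w * l * l)) > 0"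
    by (simp add: reversal_sign_Suc mult_ac)
  then show ?thesis
    using pos(2) by (simp add: reversal_sign_square zero_less_mult_iff)
qed

text \<open>The pairing of polynomials of degree at most \<open>j\<close> with those of degree below
  \<open>n\<close> has the rank of the Toeplitz matrix. Multilinear expansion in \<open>f\<close>
  and then in \<open>e\<close> leaves minors of the array \<open>c (u + s)\<close>, all of which
  vanish.\<close>

lemma gram_rank_zero:
  assumes zero: "minors_zero k (toeplitz_entry c 1 j) (Suc j) n"
    and deg: "\<And>p. p < k \<Longrightarrow> degree (e p) \<le> j" "\<And>q. q < k \<Longrightarrow> degree (f q) < n"
  shows "minor k (\<lambda>p q. moment c (e p * f q)) id id = 0"
proof -
  \<comment> \<open>Replacing \<open>u\<close> by \<open>j - u\<close> turns the Hankel array into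
    the Toeplitz matrix. The index maps are arbitrary, so \<open>minor_zero_idx\<close> is applied
    to the columns and, after transposition, to the rows.\<close>
  have arb: "minor k (\<lambda>u s. c (u + s)) h g = 0" if h: "\<And>a. a < k \<Longrightarrow> h a < Suc j" and g: "\<And>a. a < k \<Longrightarrow> g a < n" for h g
  proof -
    have "minor k (\<lambda>q p. toeplitz_entry c 1 j p q) g f = 0" if f: "f \<in> idx k (Suc j)" for f
    proof -
      have "minor k (toeplitz_entry c 1 j) f g = 0"
        by (rule minor_zero_idx[OF _ g]) (use zero f in \<open>simp add: minors_zero_def\<close>)
      then show ?thesis by (simp only: minor_transpose[of k "toeplitz_entry c 1 j"])
    qed
    then have "minor k (\<lambda>q p. toeplitz_entry c 1 j p q) g (\<lambda>a. j - h a) = 0"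
      by (rule minor_zero_idx[where n = "Suc j"]) (auto simp: less_Suc_eq_le)
    moreover have "minor k (\<lambda>u s. c (u + s)) h g = minor k (toeplitz_entry c 1 j) (\<lambda>a. j - h a) g"
      by (rule minor_cong) (use h in \<open>simp add: toeplitz_entry_1 less_Suc_eq_le add.commute\<close>)
    ultimately show ?thesis by (simp only: minor_transpose[of k "toeplitz_entry c 1 j"])
  qed
  have rows: "minor k (\<lambda>p s. \<Sum>u\<in>{..j}. c (u + s) * coeff (e p) u) id g = 0" if "\<And>a. a < k \<Longrightarrow> g a < n" for g
  proof -
    have "minor k (\<lambda>p s. \<Sum>u\<in>{..j}. c (u + s) * coeff (e p) u) id g =
        minor k (\<lambda>s p. \<Sum>u\<in>{..j}. c (u + s) * coeff (e p) u) g id"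
      by (rule minor_transpose)
    also have "\<dots> = (\<Sum>h\<in>PiE {..<k} (\<lambda>_. {..j}). (\<Prod>b<k. coeff (e (id b)) (h b)) * minor k (\<lambda>s u. c (u + s)) g h)"
      by (rule minor_expand) simp
    also have "\<dots> = 0"
    proof (intro sum.neutral ballI)
      fix h assume "h \<in> PiE {..<k} (\<lambda>_. {..j})"
      then have "h a < Suc j" if "a < k" for a
        using PiE_mem[of h "{..<k}" "\<lambda>_. {..j}" a] that by (simp add: less_Suc_eq_le)
      then have "minor k (\<lambda>u s. c (u + s)) h g = 0" using that by (intro arb) auto
      then show "(\<Prod>b<k. coeff (e (id b)) (h b)) * minor k (\<lambda>s u. c (u + s)) g h = 0"
        by (simp only: minor_transpose[of k "\<lambda>u s. c (u + s)"] mult_zero_right)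
    qed
    finally show ?thesis .
  qed
  have "minor k (\<lambda>p q. moment c (e p * f q)) id id =
      minor k (\<lambda>p q. \<Sum>s\<in>{..<n}. (\<Sum>u\<in>{..j}. c (u + s) * coeff (e p) u) * coeff (f q) s) id id"
  proof (rule minor_cong)
    fix p q assume pq: "p < k" "q < k"
    have "moment c (e p * f q) = (\<Sum>s<n. coeff (f q) s * moment c (e p * monom 1 s))"
      using deg(2) pq by (intro moment_mult_expand) simp
    also have "\<dots> = (\<Sum>s<n. coeff (f q) s * (\<Sum>u<Suc j. coeff (e p) u * moment c (monom 1 s * monom 1 u)))"
      using moment_mult_expand[of "e p" "Suc j" c "monom 1 _"] deg(1) pq by (simp add: mult.commute less_Suc_eq_le del: sum.lessThan_Suc)
    finally show "moment c (e (id p) * f (id q)) =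
        (\<Sum>s\<in>{..<n}. (\<Sum>u\<in>{..j}. c (u + s) * coeff (e (id p)) u) * coeff (f (id q)) s)"
      by (simp add: mult_monom mult_ac add_ac lessThan_Suc_atMost del: sum.lessThan_Suc)
  qed
  also have "\<dots> = (\<Sum>h\<in>PiE {..<k} (\<lambda>_. {..<n}). (\<Prod>b<k. coeff (f (id b)) (h b)) *
      minor k (\<lambda>p s. \<Sum>u\<in>{..j}. c (u + s) * coeff (e p) u) id h)"
    by (rule minor_expand) simp
  also have "\<dots> = 0"
  proof (intro sum.neutral ballI)
    fix h assume "h \<in> PiE {..<k} (\<lambda>_. {..<n})"
    then have "h a < n" if "a < k" for a
      using PiE_mem[of h "{..<k}" "\<lambda>_. {..<n}" a] that by simp
    then show "(\<Prod>b<k. coeff (f (id b)) (h b)) *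
        minor k (\<lambda>p s. \<Sum>u\<in>{..j}. c (u + s) * coeff (e p) u) id h = 0"
      using rows[of h] by (simp only: mult_zero_right)
  qed
  finally show ?thesis .
qed

section \<open>Perturbation and the abstract Hodge--Riemann relation\<close>

text \<open>At \<open>t = -e\<close> the factor \<open>[:e, 1:]\<close> vanishes while
  \<open>[:1, e:]\<close> takes the value \<open>1 - e * e\<close>. So the term free of
  \<open>[:e, 1:]\<close> has coefficient zero, the factor cancels from the rest, and induction
  applies.\<close>

lemma power_basis_independent:
  fixes e :: real
  assumes e: "e * e \<noteq> 1"
    and "(\<Sum>p<k. Polynomial.smult (w p) ([:e, 1:] ^ p * [:1, e:] ^ (k - 1 - p))) = 0" "p < k"
  shows "w p = 0"
  using assms(2,3)
proof (induction k arbitrary: w p)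
  case (Suc k)
  let ?u = "[:e, 1:]" and ?v = "[:1, e:]"
  let ?R = "\<Sum>p<k. Polynomial.smult (w (Suc p)) (?u ^ p * ?v ^ (k - 1 - p))"
  have "(\<Sum>p<Suc k. Polynomial.smult (w p) (?u ^ p * ?v ^ (Suc k - 1 - p))) =
      Polynomial.smult (w 0) (?v ^ k) + (\<Sum>p<k. Polynomial.smult (w (Suc p)) (?u ^ Suc p * ?v ^ (k - Suc p)))"
    by (subst sum.lessThan_Suc_shift) simp
  also have "(\<Sum>p<k. Polynomial.smult (w (Suc p)) (?u ^ Suc p * ?v ^ (k - Suc p))) = ?u * ?R"
    unfolding sum_distrib_left by (intro sum.cong) (auto simp only: power_Suc mult_smult_right mult.assoc diff_diff_left plus_1_eq_Suc)
  finally have rel: "Polynomial.smult (w 0) (?v ^ k) + ?u * ?R = 0" using Suc.prems(1) by argo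
  then have "poly (Polynomial.smult (w 0) (?v ^ k) + ?u * ?R) (- e) = 0" by simp
  then have w0: "w 0 = 0" using e by (simp add: poly_power)
  then have "?u * ?R = 0" using rel by simp
  then have "?R = 0" by (simp only: mult_eq_0_iff) simp
  then have "w (Suc p) = 0" if "p < k" for p
    using Suc.IH[of "\<lambda>p. w (Suc p)"] that by blast
  then show ?case using w0 Suc.prems(2) by (cases p) auto
qed simp

lemma coeff_det_power_basis:
  fixes e :: real
  assumes "e * e \<noteq> 1"
  shows "coeff_det k (\<lambda>p. [:e, 1:] ^ p * [:1, e:] ^ (k - 1 - p)) \<noteq> 0"
proof
  assume zero: "coeff_det k (\<lambda>p. [:e, 1:] ^ p * [:1, e:] ^ (k - 1 - p)) = 0"
  have "degree ([:e, 1:] ^ p * [:1, e:] ^ (k - 1 - p)) < k" if "p < k" for p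
  proof -
    have "degree ([:e, 1:] ^ p) \<le> p" "degree ([:1, e:] ^ (k - 1 - p)) \<le> k - 1 - p"
      using degree_power_le[of "[:e, 1:]" p] degree_power_le[of "[:1, e:]" "k - 1 - p"]
      by (simp_all split: if_splits)
    then show ?thesis
      using degree_mult_le[of "[:e, 1:] ^ p" "[:1, e:] ^ (k - 1 - p)"] that by linarith
  qed
  from coeff_det_zero[OF zero this] power_basis_independent[OF assms] show False by blast
qed

text \<open>The sequence of normalized coefficients of \<open>F\<close> after the substitution of \<open>x + e y\<close> for \<open>x\<close> and
  \<open>y + e x\<close> for \<open>y\<close> in the pairing.\<close>

definition perturb :: "(nat \<Rightarrow> real) \<Rightarrow> nat \<Rightarrow> real \<Rightarrow> nat \<Rightarrow> real" where
  "perturb c d e n = moment c ([:e, 1:] ^ n * [:1, e:] ^ (d - n))"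

lemma degree_linear_power: "degree ([:x, y :: real:] ^ n) \<le> n"
  using degree_power_le[of "[:x, y:]" n] by (simp split: if_splits)

text \<open>The entries share the weight \<open>w\<close>, and what remains is a Gram matrix of the
  family \<open>E\<close>, reversed on the row side. The coefficient determinant of \<open>E\<close>
  therefore enters squared, and the sign of the reversal turns the Hankel determinant into the
  Toeplitz one.\<close>

lemma minor_perturb:
  assumes "p + k \<le> Suc j" "q + k \<le> d - j + 1" "j \<le> d" "0 < k"
  shows "minor k (toeplitz_entry (perturb c d e) 1 j) (\<lambda>a. p + a) (\<lambda>a. q + a) =
    (coeff_det k (\<lambda>p. [:e, 1:] ^ p * [:1, e:] ^ (k - 1 - p)))\<^sup>2 *
    toeplitz_det c k ([:e, 1:] ^ (j + q + 1 - p - k) * [:1, e:] ^ (d + 1 + p - j - q - k))"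
proof -
  let ?u = "[:e, 1:]" and ?v = "[:1, e:]"
  define E where "E p = ?u ^ p * ?v ^ (k - 1 - p)" for p
  define w where "w = ?u ^ (j + q + 1 - p - k) * ?v ^ (d + 1 + p - j - q - k)"
  have deg: "degree (E p) < k" if "p < k" for p
    unfolding E_def using degree_mult_le[of "?u ^ p" "?v ^ (k - 1 - p)"] degree_linear_power[of e 1 p]
      degree_linear_power[of 1 e "k - 1 - p"] that by linarith
  have "minor k (toeplitz_entry (perturb c d e) 1 j) (\<lambda>a. p + a) (\<lambda>a. q + a) =
      minor k (\<lambda>a b. moment c (w * E (k - 1 - a) * E b)) id id"
  proof (rule minor_cong)
    fix a b assume ab: "a < k" "b < k"
    \<comment> \<open>The exponents of \<open>?u\<close> and \<open>?v\<close> in entry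
      \<open>(a, b)\<close>; the bounds on \<open>p\<close> and \<open>q\<close> keep every
      truncated subtraction exact.\<close>
    have x: "(j + q + 1 - p - k) + (k - 1 - a) + b = j + (q + b) - (p + a)"
      using assms ab by linarith
    have y: "(d + 1 + p - j - q - k) + a + (k - 1 - b) = d - (j + (q + b) - (p + a))"
      using assms ab by linarith
    have a: "k - 1 - (k - 1 - a) = a" using ab by simp
    have "w * E (k - 1 - a) * E b = ?u ^ ((j + q + 1 - p - k) + (k - 1 - a) + b) *
        ?v ^ ((d + 1 + p - j - q - k) + a + (k - 1 - b))"
      unfolding w_def E_def a power_add by (simp only: mult_ac)
    then have eq: "w * E (k - 1 - a) * E b =
        ?u ^ (j + (q + b) - (p + a)) * ?v ^ (d - (j + (q + b) - (p + a)))"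
      unfolding x y .
    show "toeplitz_entry (perturb c d e) 1 j (p + a) (q + b) = moment c (w * E (k - 1 - id a) * E (id b))"
      unfolding toeplitz_entry_1 perturb_def id_apply eq ..
  qed
  also have "\<dots> = coeff_det k (\<lambda>p. E (k - 1 - p)) * hankel_det c k w * coeff_det k E"
    by (rule gram_det) (use deg in auto)
  also have "\<dots> = (coeff_det k E)\<^sup>2 * toeplitz_det c k w"
    using coeff_det_rev[of k E] deg by (simp add: toeplitz_det_hdet power2_eq_square)
  finally show ?thesis unfolding E_def[abs_def] w_def .
qed

text \<open>\<open>toeplitz_det_prod\<close> for the original Toeplitz matrix, whose two dimensions
  add up to \<open>d + 2\<close>. Size \<open>0\<close>, with determinant \<open>1\<close>, is
  included to cover degree \<open>0\<close> and rank \<open>0\<close>.\<close>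

lemma toeplitz_det_pos:
  assumes "k > 0 \<longrightarrow> minors_pos k (toeplitz_entry c 1 i) (Suc i) (d - i + 1)"
    and "i \<le> d div 2" "set ls \<subseteq> pos_lin" "length ls + 2 * k = d + 2"
  shows "toeplitz_det c k (prod_list ls) > 0"
proof (cases "k = 0")
  case False
  then have pos: "minors_pos k (toeplitz_entry c 1 i) (Suc i) (d - i + 1)" using assms by simp
  then have "k \<le> Suc i" "k \<le> d - i + 1" unfolding minors_pos_def using idx_le by blast+
  then have "toeplitz_det c k (1 * prod_list ls) > 0"
    using False assms(2-) by (intro toeplitz_det_prod(1)[OF _ _ _ _ _ pos]) auto
  then show ?thesis by simp
qed (simp add: toeplitz_det_def)

text \<open>By \<open>minor_perturb\<close> the consecutive minors of size \<open>k\<close> are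
  squares times Toeplitz determinants along \<open>d + 2 - 2 * k\<close> linear forms, which are
  positive because \<open>e > 0\<close>; \<open>e < 1\<close> makes the squares nonzero. Both parts
  of Fekete's criterion then apply.\<close>

lemma perturb_minors:
  assumes ij: "j \<le> i" "i \<le> d div 2" and e: "0 < e" "e < 1"
    and pos: "\<And>k. k \<le> r \<Longrightarrow> minors_pos k (toeplitz_entry c 1 i) (Suc i) (d - i + 1)"
    and zero: "minors_zero (Suc r) (toeplitz_entry c 1 i) (Suc i) (d - i + 1)"
  shows "k \<le> r \<Longrightarrow> f \<in> idx k (Suc j) \<Longrightarrow> g \<in> idx k (d - j + 1) \<Longrightarrow>
      minor k (toeplitz_entry (perturb c d e) 1 j) f g > 0"
    "f \<in> idx (Suc r) (Suc j) \<Longrightarrow> g \<in> idx (Suc r) (d - j + 1) \<Longrightarrow>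
      minor (Suc r) (toeplitz_entry (perturb c d e) 1 j) f g = 0"
proof -
  have "e * e < 1 * 1" using e by (intro mult_strict_mono) auto
  then have coeff_det: "(coeff_det k (\<lambda>p. [:e, 1:] ^ p * [:1, e:] ^ (k - 1 - p)))\<^sup>2 > 0" for k
    using coeff_det_power_basis[of e k] by simp
  define ls where "ls k p q = replicate (j + q + 1 - p - k) [:e, 1:] @ replicate (d + 1 + p - j - q - k) [:1, e:]"
    for k p q
  have ls: "set (ls k p q) \<subseteq> pos_lin" for k p q
    using e by (auto simp: ls_def pos_lin_def)
  have prod: "prod_list (ls k p q) = [:e, 1:] ^ (j + q + 1 - p - k) * [:1, e:] ^ (d + 1 + p - j - q - k)" for k p q
    by (simp only: ls_def prod_list.append prod_list_replicate)
  have len: "length (ls k p q) + 2 * k = d + 2" if "p + k \<le> Suc j" "q + k \<le> d - j + 1" for k p q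
    using that ij by (simp add: ls_def)
  have solid: "minor k (toeplitz_entry (perturb c d e) 1 j) (\<lambda>a. p + a) (\<lambda>a. q + a) > 0"
    if "k \<le> r" "p + k \<le> Suc j" "q + k \<le> d - j + 1" for k p q
  proof (cases "k = 0")
    case False
    have "toeplitz_det c k (prod_list (ls k p q)) > 0"
      using toeplitz_det_pos[OF _ ij(2) ls len] pos that by blast
    then have "(coeff_det k (\<lambda>p. [:e, 1:] ^ p * [:1, e:] ^ (k - 1 - p)))\<^sup>2 * toeplitz_det c k (prod_list (ls k p q)) > 0"
      by (rule mult_pos_pos[OF coeff_det])
    then show ?thesis
      using minor_perturb[of p k j q d c e] that ij False unfolding prod by simp
  qed simp
  have solid0: "minor (Suc r) (toeplitz_entry (perturb c d e) 1 j) (\<lambda>a. p + a) (\<lambda>a. q + a) = 0"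
    if "p + Suc r \<le> Suc j" "q + Suc r \<le> d - j + 1" for p q
  proof -
    have "toeplitz_det c (Suc r) (1 * prod_list (ls (Suc r) p q)) = 0"
      by (rule toeplitz_det_prod(2)[OF ls _ _ _ _ zero]) (use len[of p "Suc r" q] that ij in auto)
    then have "(coeff_det (Suc r) (\<lambda>p. [:e, 1:] ^ p * [:1, e:] ^ (Suc r - 1 - p)))\<^sup>2 *
        toeplitz_det c (Suc r) (prod_list (ls (Suc r) p q)) = 0" by simp
    then show ?thesis
      using minor_perturb[of p "Suc r" j q d c e] that ij unfolding prod by simp
  qed
  show "minor k (toeplitz_entry (perturb c d e) 1 j) f g > 0"
    if "k \<le> r" "f \<in> idx k (Suc j)" "g \<in> idx k (d - j + 1)"
    by (rule fekete[where r = r and m = "Suc j" and n = "d - j + 1"]) (use solid that in auto)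
  show "minor (Suc r) (toeplitz_entry (perturb c d e) 1 j) f g = 0"
    if "f \<in> idx (Suc r) (Suc j)" "g \<in> idx (Suc r) (d - j + 1)"
    by (rule fekete_zero[where m = "Suc j" and n = "d - j + 1"]) (use solid solid0 that in auto)
qed

section \<open>The limit of vanishing perturbation\<close>

lemma tendsto_minor:
  assumes "\<And>a b. a < k \<Longrightarrow> b < k \<Longrightarrow> ((\<lambda>x. M x (f a) (g b)) \<longlongrightarrow> N (f a) (g b)) F"
  shows "((\<lambda>x. minor k (M x) f g) \<longlongrightarrow> minor k N f g) F"
proof -
  have eq: "minor k M f g = (\<Sum>p | p permutes {0..<k}. signof p * (\<Prod>b<k. M (f (p b)) (g b)))" for M
    unfolding minor_def by (subst det_col[of _ k]) (auto intro!: sum.cong prod.cong dest: permutes_in_image)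
  show ?thesis
    unfolding eq
    by (intro tendsto_sum tendsto_mult tendsto_const tendsto_prod assms)
       (auto dest: permutes_in_image)
qed

lemma tendsto_coeff_mult:
  fixes P Q :: "'a \<Rightarrow> real poly"
  assumes "\<And>n. ((\<lambda>x. coeff (P x) n) \<longlongrightarrow> coeff p n) F" "\<And>n. ((\<lambda>x. coeff (Q x) n) \<longlongrightarrow> coeff q n) F"
  shows "((\<lambda>x. coeff (P x * Q x) n) \<longlongrightarrow> coeff (p * q) n) F"
  unfolding coeff_mult by (intro tendsto_intros assms)

lemma tendsto_coeff_power:
  fixes P :: "'a \<Rightarrow> real poly"
  assumes "\<And>n. ((\<lambda>x. coeff (P x) n) \<longlongrightarrow> coeff p n) F"
  shows "((\<lambda>x. coeff (P x ^ m) n) \<longlongrightarrow> coeff (p ^ m) n) F"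
proof (induction m arbitrary: n)
  case (Suc m)
  then show ?case unfolding power_Suc by (intro tendsto_coeff_mult assms)
qed simp

text \<open>At \<open>e = 0\<close> the two linear factors become \<open>t\<close> and
  \<open>1\<close>, so the polynomial under the functional tends coefficientwise to
  \<open>monom 1 n\<close>. The degree bound \<open>d\<close> turns the functional into a fixed
  finite sum.\<close>

lemma tendsto_perturb:
  assumes "n \<le> d"
  shows "((\<lambda>e. perturb c d e n) \<longlongrightarrow> c n) (at_right 0)"
proof -
  have u: "((\<lambda>e. coeff [:e, 1 :: real:] n) \<longlongrightarrow> coeff [:0, 1:] n) (at_right 0)" for n
    by (auto simp: coeff_pCons split: nat.split)
  have v: "((\<lambda>e. coeff [:1 :: real, e:] n) \<longlongrightarrow> coeff [:1, 0:] n) (at_right 0)" for n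
  proof -
    consider "n = 0" | "n = 1" | m where "n = Suc (Suc m)" by (metis One_nat_def not0_implies_Suc)
    then show ?thesis by cases (auto simp: coeff_pCons)
  qed
  have "degree ([:e, 1:] ^ n * [:1, e:] ^ (d - n)) \<le> d" for e :: real
    using degree_mult_le[of "[:e, 1:] ^ n" "[:1, e:] ^ (d - n)"] degree_linear_power[of e 1 n]
      degree_linear_power[of 1 e "d - n"] assms by linarith
  then have eq: "perturb c d e n = (\<Sum>m\<le>d. coeff ([:e, 1:] ^ n * [:1, e:] ^ (d - n)) m * c m)" for e
    unfolding perturb_def by (intro moment_bound)
  have "((\<lambda>e. perturb c d e n) \<longlongrightarrow> (\<Sum>m\<le>d. coeff ([:0, 1:] ^ n * [:1, 0:] ^ (d - n)) m * c m)) (at_right 0)"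
    unfolding eq by (intro tendsto_intros tendsto_coeff_mult tendsto_coeff_power u v)
  moreover have "[:0, 1:] ^ n * [:1, 0:] ^ (d - n) = monom (1 :: real) n"
    by (simp add: monom_altdef flip: one_pCons)
  ultimately show ?thesis
    using assms by (simp add: if_distrib[of "\<lambda>x. x * _"] cong: if_cong)
qed

text \<open>Letting \<open>e\<close> tend to \<open>0\<close> in \<open>perturb_minors\<close> keeps
  vanishing and turns positivity into nonnegativity. Vanishing in size \<open>r + 1\<close> passes
  to larger sizes by Laplace expansion, so the matrix for \<open>j\<close> has rank at most
  \<open>r\<close>.\<close>

lemma toeplitz_minors_down:
  assumes ij: "j \<le> i" "i \<le> d div 2"
    and pos: "\<And>k. k \<le> r \<Longrightarrow> minors_pos k (toeplitz_entry c 1 i) (Suc i) (d - i + 1)"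
    and zero: "minors_zero (Suc r) (toeplitz_entry c 1 i) (Suc i) (d - i + 1)"
  shows "k \<le> r \<Longrightarrow> f \<in> idx k (Suc j) \<Longrightarrow> g \<in> idx k (d - j + 1) \<Longrightarrow> minor k (toeplitz_entry c 1 j) f g \<ge> 0"
    "r < k \<Longrightarrow> minors_zero k (toeplitz_entry c 1 j) (Suc j) (d - j + 1)"
proof -
  have lim: "((\<lambda>e. minor k (toeplitz_entry (perturb c d e) 1 j) f g) \<longlongrightarrow> minor k (toeplitz_entry c 1 j) f g) (at_right 0)"
    if "f \<in> idx k (Suc j)" "g \<in> idx k (d - j + 1)" for k f g
  proof (rule tendsto_minor)
    fix a b assume "a < k" "b < k"
    then have "f a < Suc j" "g b < d - j + 1" using that idx_bound by blast+
    then have "j + g b - f a \<le> d" using ij by linarith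
    then show "((\<lambda>e. toeplitz_entry (perturb c d e) 1 j (f a) (g b)) \<longlongrightarrow> toeplitz_entry c 1 j (f a) (g b)) (at_right 0)"
      unfolding toeplitz_entry_1 by (rule tendsto_perturb)
  qed
  have ev: "eventually (\<lambda>e. 0 < e \<and> e < 1) (at_right (0 :: real))"
    by (auto simp: eventually_at_right_field intro: exI[of _ 1])
  show "minor k (toeplitz_entry c 1 j) f g \<ge> 0"
    if "k \<le> r" and fg: "f \<in> idx k (Suc j)" "g \<in> idx k (d - j + 1)"
  proof (rule tendsto_lowerbound[OF lim[OF fg]])
    show "eventually (\<lambda>e. 0 \<le> minor k (toeplitz_entry (perturb c d e) 1 j) f g) (at_right 0)"
      using ev perturb_minors(1)[OF ij _ _ pos zero that] by (auto elim!: eventually_mono intro: less_imp_le)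
  qed simp
  have "minors_zero (Suc r) (toeplitz_entry c 1 j) (Suc j) (d - j + 1)"
    unfolding minors_zero_def
  proof (intro ballI)
    fix f g assume fg: "f \<in> idx (Suc r) (Suc j)" "g \<in> idx (Suc r) (d - j + 1)"
    have "eventually (\<lambda>e. minor (Suc r) (toeplitz_entry (perturb c d e) 1 j) f g = 0) (at_right 0)"
      using ev perturb_minors(2)[OF ij _ _ pos zero fg] by (auto elim!: eventually_mono)
    then have "((\<lambda>e. minor (Suc r) (toeplitz_entry (perturb c d e) 1 j) f g) \<longlongrightarrow> 0) (at_right 0)"
      by (rule tendsto_eventually)
    then show "minor (Suc r) (toeplitz_entry c 1 j) f g = 0"
      using lim[OF fg] by (intro tendsto_unique) auto
  qed
  then show "minors_zero k (toeplitz_entry c 1 j) (Suc j) (d - j + 1)" if "r < k"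
    using that
  proof (induction k)
    case (Suc k)
    show ?case
    proof (cases "r = k")
      case False
      then have "minors_zero k (toeplitz_entry c 1 j) (Suc j) (d - j + 1)" using Suc by simp
      then show ?thesis
        unfolding minors_zero_def using minor_nonzero_down by metis
    qed (use Suc in simp)
  qed simp
qed

section \<open>Rank and the two cases of the Hodge-Riemann relation\<close>

lemma totally_nonneg_rank:
  assumes "\<And>k f g. f \<in> idx k m \<Longrightarrow> g \<in> idx k n \<Longrightarrow> minor k M f g \<ge> 0"
  obtains r where "\<And>k. k \<le> r \<Longrightarrow> minors_pos k M m n" "\<And>k. r < k \<Longrightarrow> minors_zero k M m n"
proof -
  have eq: "minors_zero k M m n \<longleftrightarrow> \<not> minors_pos k M m n" for k
    unfolding minors_pos_def minors_zero_def using assms by (metis less_le not_le order_refl)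
  have down: "minors_pos k M m n" if "minors_pos (Suc k) M m n" for k
  proof -
    obtain f g where "f \<in> idx (Suc k) m" "g \<in> idx (Suc k) n" "minor (Suc k) M f g \<noteq> 0"
      using \<open>minors_pos (Suc k) M m n\<close> unfolding minors_pos_def by (metis less_irrefl)
    then have "\<not> minors_zero k M m n"
      unfolding minors_zero_def using minor_nonzero_down by metis
    then show ?thesis using eq by blast
  qed
  have down': "minors_pos k M m n" if "minors_pos l M m n" "k \<le> l" for k l
    using that(2,1) by (induction rule: dec_induct) (auto intro: down)
  have bound: "k \<le> m" if "minors_pos k M m n" for k
    using that idx_le unfolding minors_pos_def by blast
  have P0: "minors_pos 0 M m n"
    unfolding minors_pos_def by (auto simp: idx_def intro!: exI[of _ id])
  \<comment> \<open>The rank is the last size with a positive minor: size \<open>0\<close> has one,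
    and beyond size \<open>m\<close> there are no index maps.\<close>
  have "\<exists>r. minors_pos r M m n \<and> \<not> minors_pos (Suc r) M m n"
  proof (rule ccontr)
    assume contr: "\<not> ?thesis"
    have "minors_pos k M m n" for k
      by (induction k) (use P0 contr in auto)
    then show False using bound Suc_n_not_le_n by blast
  qed
  then obtain r where r: "minors_pos r M m n" "\<not> minors_pos (Suc r) M m n" by blast
  show ?thesis
  proof (rule that)
    show "minors_pos k M m n" if "k \<le> r" for k using down' r(1) that by blast
    show "minors_zero k M m n" if "r < k" for k
      unfolding eq using down'[of k "Suc r"] r(2) that by auto
  qed
qed

text \<open>The Hodge-Riemann relation at \<open>y = 1\<close>: \<open>p\<close> witnesses that the
  class of \<open>\<alpha>\<close> is nonzero, and \<open>prim\<close> is primitivity tested on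
  powers of \<open>t\<close>. Below the rank \<open>primitive_sign\<close> applies; from the rank on
  the hypotheses are contradictory.\<close>

lemma primitive_positive:
  fixes l :: "nat \<Rightarrow> real poly"
  assumes ij: "j \<le> i" "i \<le> d div 2"
    and nonneg: "\<And>k f g. f \<in> idx k (Suc i) \<Longrightarrow> g \<in> idx k (d - i + 1) \<Longrightarrow> minor k (toeplitz_entry c 1 i) f g \<ge> 0"
    and l: "\<And>k. k \<le> d \<Longrightarrow> l k \<in> pos_lin"
    and deg: "degree \<alpha> \<le> j"
    and nz: "p \<le> d - j" "moment c (\<alpha> * monom 1 p) \<noteq> 0"
    and prim: "\<And>b. b < j \<Longrightarrow> moment c ((\<Prod>k=0..d - 2 * j. l k) * \<alpha> * monom 1 b) = 0"
  shows "(-1) ^ j * moment c ((\<Prod>k=1..d - 2 * j. l k) * \<alpha> * \<alpha>) > 0"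
proof -
  obtain r where r: "\<And>k. k \<le> r \<Longrightarrow> minors_pos k (toeplitz_entry c 1 i) (Suc i) (d - i + 1)"
    "\<And>k. r < k \<Longrightarrow> minors_zero k (toeplitz_entry c 1 i) (Suc i) (d - i + 1)"
    using totally_nonneg_rank[OF nonneg] by blast
  define ls where "ls = map l [1..<d - 2 * j + 1]"
  define w where "w = (\<Prod>k=1..d - 2 * j. l k)"
  have ls: "set ls \<subseteq> pos_lin" "length ls = d - 2 * j" using l by (auto simp: ls_def)
  have w: "w = prod_list ls"
    unfolding w_def ls_def
    by (simp add: prod.distinct_set_conv_list[symmetric] atLeastLessThanSuc_atLeastAtMost del: upt_Suc)
  have l0: "l 0 \<in> pos_lin" using l by simp
  then have l0_deg: "degree (l 0) \<le> 1" "l 0 \<noteq> 0" by (auto simp: pos_lin_def)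
  have w0: "(\<Prod>k=0..d - 2 * j. l k) = w * l 0"
    unfolding w_def by (simp add: prod.atLeast_Suc_atMost mult.commute)
  have prim': "moment c (w * l 0 * \<alpha> * q) = 0" if "degree q < j" for q
    unfolding moment_mult_expand[OF that] using prim unfolding w0 by simp
  have tpos: "toeplitz_det c k (prod_list ks) > 0"
    if "k \<le> r" "set ks \<subseteq> pos_lin" "length ks + 2 * k = d + 2" for k ks
    using toeplitz_det_pos[OF _ ij(2) that(2,3)] r(1)[OF that(1)] by blast
  show ?thesis
    unfolding w_def[symmetric]
  proof (cases "j < r")
    case True
    show "(-1) ^ j * moment c (w * \<alpha> * \<alpha>) > 0"
    proof (rule primitive_sign)
      show "toeplitz_det c (Suc j) w > 0"
        unfolding w using ls ij True by (intro tpos) auto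
      \<comment> \<open>Two further copies of \<open>l 0\<close> give the
        \<open>d + 2 - 2 * j\<close> factors required for size \<open>j\<close>.\<close>
      have "toeplitz_det c j (prod_list (ls @ [l 0, l 0])) > 0"
        using ls l0 ij True by (intro tpos) auto
      then show "toeplitz_det c j (w * l 0 * l 0) > 0" by (simp add: w mult.assoc)
      show "\<alpha> \<noteq> 0" using nz by auto
      show "moment c (w * l 0 * \<alpha> * monom 1 b) = 0" if "b < j" for b
        using that by (intro prim') (simp add: degree_monom_eq)
    qed (use deg l0_deg in auto)
  next
    case False
    \<comment> \<open>For \<open>j \<ge> r\<close>, a nonzero primitive class would give a
      nonsingular Gram matrix of size \<open>r + 1\<close>, against rank at most \<open>r\<close>.
      Here \<open>f 0\<close> detects \<open>\<alpha>\<close>, while every other \<open>f s\<close>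
      is \<open>w * l 0\<close> times a polynomial of degree below \<open>j\<close>, hence
      orthogonal to \<open>\<alpha>\<close>. The powers of \<open>l 0\<close> make the remaining
      block a Hankel matrix whose weight has \<open>d + 2 - 2 * r\<close> linear factors, so it is
      nonsingular.\<close>
    define e where "e s = (if s = 0 then \<alpha> else l 0 ^ (j - r + 1) * monom 1 (s - 1))" for s
    define f where "f s = (if s = 0 then monom 1 p else w * l 0 * (l 0 ^ (j - r) * monom 1 (s - 1)))" for s
    have deg_l0: "degree (l 0 ^ n * monom 1 m) \<le> n + m" for n m
    proof -
      have "degree (l 0 ^ n) \<le> 1 * n"
        using degree_power_le[of "l 0" n] l0_deg(1) by (meson le_trans mult_le_mono1)
      then show ?thesis
        using degree_mult_le[of "l 0 ^ n" "monom 1 m"] degree_monom_le[of "1 :: real" m] by linarith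
    qed
    have deg_w: "degree w \<le> d - 2 * j"
    proof -
      have "degree (prod_list ks) \<le> length ks" if "set ks \<subseteq> pos_lin" for ks
        using that
      proof (induction ks)
        case (Cons k ks)
        then have "degree k \<le> 1" by (auto simp: pos_lin_def)
        then show ?case using Cons degree_mult_le[of k "prod_list ks"] by simp
      qed simp
      then show ?thesis using ls w by metis
    qed
    have gram: "minor (Suc r) (\<lambda>s t. moment c (e s * f t)) id id = 0"
    proof (rule gram_rank_zero)
      show "minors_zero (Suc r) (toeplitz_entry c 1 j) (Suc j) (d - j + 1)"
        using toeplitz_minors_down(2)[OF ij r(1) r(2)] by simp
    next
      fix s assume s: "s < Suc r"
      show "degree (e s) \<le> j"
        unfolding e_def using deg deg_l0[of "j - r + 1" "s - 1"] s False by auto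
      have "degree (w * l 0 * (l 0 ^ (j - r) * monom 1 (s - 1))) \<le> (d - 2 * j) + 1 + (j - r + (s - 1))"
        using degree_mult_le[of w "l 0"] degree_mult_le[of "w * l 0" "l 0 ^ (j - r) * monom 1 (s - 1)"]
          deg_w l0_deg(1) deg_l0[of "j - r" "s - 1"] by linarith
      then show "degree (f s) < d - j + 1"
        unfolding f_def using nz(1) s False ij by (auto simp: degree_monom_eq)
    qed
    have "minor (Suc r) (\<lambda>s t. moment c (e s * f t)) id id =
        (\<Sum>q\<le>r. (-1) ^ (q + 0) * moment c (e (id 0) * f (id q)) *
          minor r (\<lambda>s t. moment c (e s * f t)) (id \<circ> skip 0) (id \<circ> skip q))"
      by (rule minor_laplace_row) simp
    also have "\<dots> = (\<Sum>q\<in>{0}. (-1) ^ (q + 0) * moment c (e (id 0) * f (id q)) *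
          minor r (\<lambda>s t. moment c (e s * f t)) (id \<circ> skip 0) (id \<circ> skip q))"
    proof (rule sum.mono_neutral_right)
      have "moment c (e 0 * f q) = 0" if "q \<noteq> 0" "q \<le> r" for q
      proof -
        have "degree (l 0 ^ (j - r) * monom 1 (q - 1)) < j"
          using deg_l0[of "j - r" "q - 1"] that False by linarith
        from prim'[OF this] show ?thesis using that by (simp add: e_def f_def mult_ac)
      qed
      then show "\<forall>q\<in>{..r} - {0}. (-1) ^ (q + 0) * moment c (e (id 0) * f (id q)) *
          minor r (\<lambda>s t. moment c (e s * f t)) (id \<circ> skip 0) (id \<circ> skip q) = 0"
        by simp
    qed auto
    also have "\<dots> = moment c (\<alpha> * monom 1 p) * minor r (\<lambda>s t. moment c (e s * f t)) (id \<circ> skip 0) (id \<circ> skip 0)"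
      by (simp add: e_def f_def)
    also have "minor r (\<lambda>s t. moment c (e s * f t)) (id \<circ> skip 0) (id \<circ> skip 0) =
        hankel_det c r (w * l 0 ^ ((j - r + 1) + (j - r + 1)))"
      unfolding hankel_det_def
    proof (rule minor_cong)
      fix a b
      have "e (Suc a) * f (Suc b) = w * l 0 ^ ((j - r + 1) + (j - r + 1)) * monom 1 (a + b)"
        by (simp add: e_def f_def monom_1_add power_add mult_ac)
      then show "moment c (e ((id \<circ> skip 0) a) * f ((id \<circ> skip 0) b)) =
          moment c (w * l 0 ^ ((j - r + 1) + (j - r + 1)) * monom 1 (id a + id b))"
        by (simp add: skip_def)
    qed
    finally have "hankel_det c r (w * l 0 ^ ((j - r + 1) + (j - r + 1))) = 0"
      using gram nz(2) by (metis mult_eq_0_iff)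
    moreover have "toeplitz_det c r (prod_list (ls @ replicate ((j - r + 1) + (j - r + 1)) (l 0))) > 0"
      using ls l0 ij False by (intro tpos) auto
    moreover have "prod_list (ls @ replicate ((j - r + 1) + (j - r + 1)) (l 0)) =
        w * l 0 ^ ((j - r + 1) + (j - r + 1))"
      by (simp only: prod_list.append prod_list_replicate w)
    ultimately have False by (simp only: toeplitz_det_hdet mult_zero_right less_irrefl)
    then show "(-1) ^ j * moment c (w * \<alpha> * \<alpha>) > 0" ..
  qed
qed

section \<open>The algebra \<open>A\<^sub>F\<close> in terms of moments\<close>

lemma forms_coeff: "P \<in> forms n \<Longrightarrow> a + b \<noteq> n \<Longrightarrow> coeff (coeff P b) a = 0"
  by (auto simp: forms_def)

lemma forms_mult:
  assumes "P \<in> forms m" "Q \<in> forms n"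
  shows "P * Q \<in> forms (m + n)"
proof -
  have "coeff (coeff (P * Q) b) a = 0" if "a + b \<noteq> m + n" for a b
    unfolding coeff_mult coeff_sum
  proof (intro sum.neutral ballI)
    fix x y assume "x \<in> {..b}" "y \<in> {..a}"
    then have "y + x \<noteq> m \<or> (a - y) + (b - x) \<noteq> n" using that by auto
    then show "coeff (coeff P x) y * coeff (coeff Q (b - x)) (a - y) = 0"
      using forms_coeff[OF assms(1), of y x] forms_coeff[OF assms(2), of "a - y" "b - x"] by auto
  qed
  then show ?thesis by (auto simp: forms_def)
qed

lemma forms_1: "1 \<in> forms 0"
  by (auto simp: forms_def one_pCons coeff_pCons split: nat.splits)

lemma forms_prod:
  assumes "\<And>k. k \<in> A \<Longrightarrow> l k \<in> forms 1"
  shows "(\<Prod>k\<in>A. l k) \<in> forms (card A)"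
  using assms
proof (induction A rule: infinite_finite_induct)
  case (insert x A)
  then show ?case using forms_mult[of "l x" 1 "prod l A" "card A"] by simp
qed (use forms_1 in auto)

lemma coeff_dehom:
  assumes "P \<in> forms n"
  shows "coeff (poly P 1) a = (if a \<le> n then coeff (coeff P (n - a)) a else 0)"
proof -
  have "coeff (poly P 1) a = (\<Sum>b\<le>max (degree P) n. coeff (coeff P b) a)"
    by (simp add: poly_altdef coeff_sum)
       (rule sum.mono_neutral_left, auto simp: coeff_eq_0)
  also have "\<dots> = (\<Sum>b\<le>max (degree P) n. if b = n - a then (if a \<le> n then coeff (coeff P (n - a)) a else 0) else 0)"
    by (intro sum.cong) (auto intro!: forms_coeff[OF assms])
  finally show ?thesis by (auto simp: le_max_iff_disj)
qed

lemma degree_dehom: "P \<in> forms n \<Longrightarrow> degree (poly P 1) \<le> n"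
  by (rule degree_le) (simp add: coeff_dehom)

lemma dehom_positive_linear:
  assumes "P \<in> positive_linear_forms"
  shows "P \<in> forms 1" "poly P 1 \<in> pos_lin"
proof -
  obtain a b where P: "P = const a * var_x + const b * var_y" "a > 0" "b > 0"
    using assms by (auto simp: positive_linear_forms_def)
  have P': "P = [:[:0, a:], [:b:]:]" by (simp add: P const_def var_x_def var_y_def)
  show "P \<in> forms 1"
    unfolding P' by (auto simp: forms_def coeff_pCons split: nat.splits)
  show "poly P 1 \<in> pos_lin"
    unfolding P' pos_lin_def using P(2,3) by auto
qed

lemma fact_shift:
  "real (Suc a) * (fact (Suc a + m) / fact (Suc a) * x) = fact (a + Suc m) / fact a * x"
proof -
  have "real (Suc a) / fact (Suc a) = 1 / fact a"
    unfolding fact_Suc by (simp del: of_nat_Suc)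
  then have "(real (Suc a) / fact (Suc a)) * (fact (Suc a + m) * x) = 1 / fact a * (fact (Suc a + m) * x)"
    by (simp only:)
  then show ?thesis by simp
qed

lemma coeff_diff_X_pow:
  "coeff (coeff ((diff_X ^^ m) P) b) a = fact (a + m) / fact a * coeff (coeff P b) (a + m)"
proof (induction m arbitrary: a)
  case (Suc m)
  have "coeff (coeff ((diff_X ^^ Suc m) P) b) a = real (Suc a) * coeff (coeff ((diff_X ^^ m) P) b) (Suc a)"
    by (simp add: diff_X_def coeff_map_poly coeff_pderiv)
  then show ?case unfolding Suc fact_shift by simp
qed simp

lemma coeff_diff_Y_pow:
  "coeff (coeff ((diff_Y ^^ m) P) b) a = fact (b + m) / fact b * coeff (coeff P (b + m)) a"
proof (induction m arbitrary: b)
  case (Suc m)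
  have "coeff (of_nat m * p) a = of_nat m * coeff p a" for m and p :: "real poly"
    by (simp add: of_nat_poly)
  then have "coeff (coeff ((diff_Y ^^ Suc m) P) b) a = real (Suc b) * coeff (coeff ((diff_Y ^^ m) P) (Suc b)) a"
    by (simp only: diff_Y_def coeff_pderiv funpow.simps o_apply)
  then show ?case unfolding Suc fact_shift by simp
qed simp

text \<open>The binomial normalization absorbs the factorials produced by differentiation, so that
  derivatives act on \<open>norm_coeff\<close> by shifts.\<close>

lemma coeff_form:
  assumes "a + b = d"
  shows "fact a * fact b * coeff (coeff F b) a = fact d * norm_coeff d F a"
proof -
  have a: "a \<le> d" "d - a = b" using assms by auto
  then have "real (d choose a) * (fact a * fact b) = fact d"
    using binomial_fact[of a d, where 'a = real] by simp
  moreover have "real (d choose a) \<noteq> 0" using a by simp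
  ultimately show ?thesis
    unfolding norm_coeff_def a(2) by (metis mult.commute mult.left_commute nonzero_mult_div_cancel_left times_divide_eq_right)
qed

text \<open>The term of \<open>\<alpha>\<close> with exponents \<open>a\<close> and \<open>b\<close>
  reaches the position \<open>(p, q)\<close> from \<open>(p + a, q + b)\<close>. The factorials
  combine by \<open>coeff_form\<close> and leave \<open>norm_coeff d F (p + a)\<close>; summing over
  \<open>a\<close> gives the moment.\<close>

lemma coeff_act:
  assumes F: "F \<in> forms d" and \<alpha>: "\<alpha> \<in> forms n"
  shows "coeff (coeff (\<alpha> \<Zcomp> F) q) p =
    (if p + q + n = d then fact d / (fact p * fact q) * moment (norm_coeff d F) (poly \<alpha> 1 * monom 1 p) else 0)"
proof -
  define T where "T a b = coeff (coeff \<alpha> b) a * (fact (p + a) / fact p *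
    (fact (q + b) / fact q * coeff (coeff F (q + b)) (p + a)))" for a b
  have "degree \<alpha> \<le> n"
    by (rule degree_le) (auto intro!: poly_eqI forms_coeff[OF \<alpha>])
  moreover have deg: "degree (coeff \<alpha> b) \<le> n" for b
    by (rule degree_le) (auto intro!: forms_coeff[OF \<alpha>])
  ultimately have "\<alpha> \<Zcomp> F = (\<Sum>b\<le>n. \<Sum>a\<le>n. const (coeff (coeff \<alpha> b) a) * (diff_X ^^ a) ((diff_Y ^^ b) F))"
    by (simp add: act_bound act_X_bound[OF deg])
  then have "coeff (coeff (\<alpha> \<Zcomp> F) q) p = (\<Sum>b\<le>n. \<Sum>a\<le>n. T a b)"
    by (simp add: coeff_sum const_def coeff_diff_X_pow coeff_diff_Y_pow T_def)
  also have "\<dots> = (\<Sum>a\<le>n. \<Sum>b\<le>n. T a b)" by (rule sum.swap)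
  also have "\<dots> = (\<Sum>a\<le>n. T a (n - a))"
  proof (rule sum.cong)
    fix a assume "a \<in> {..n}"
    then have "T a b = 0" if "b \<noteq> n - a" for b
      using that forms_coeff[OF \<alpha>, of a b] by (auto simp: T_def)
    then have "(\<Sum>b\<le>n. T a b) = (\<Sum>b\<in>{n - a}. T a b)"
      by (intro sum.mono_neutral_right) auto
    then show "(\<Sum>b\<le>n. T a b) = T a (n - a)" by simp
  qed simp
  finally have sum: "coeff (coeff (\<alpha> \<Zcomp> F) q) p = (\<Sum>a\<le>n. T a (n - a))" .
  show ?thesis
  proof (cases "p + q + n = d")
    case True
    have "T a (n - a) = fact d / (fact p * fact q) * (coeff (poly \<alpha> 1) a * norm_coeff d F (p + a))"
      if "a \<le> n" for a
    proof -
      have "fact (p + a) * fact (q + (n - a)) * coeff (coeff F (q + (n - a))) (p + a) = fact d * norm_coeff d F (p + a)"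
        by (rule coeff_form) (use True that in simp)
      then show ?thesis
        using that by (simp add: T_def coeff_dehom[OF \<alpha>] field_simps)
    qed
    then have "(\<Sum>a\<le>n. T a (n - a)) =
        fact d / (fact p * fact q) * (\<Sum>a<Suc n. coeff (poly \<alpha> 1) a * norm_coeff d F (p + a))"
      unfolding sum_distrib_left lessThan_Suc_atMost by (intro sum.cong) auto
    also have "(\<Sum>a<Suc n. coeff (poly \<alpha> 1) a * norm_coeff d F (p + a)) =
        moment (norm_coeff d F) (monom 1 p * poly \<alpha> 1)"
      using degree_dehom[OF \<alpha>] by (subst moment_mult_expand[of _ "Suc n"]) (auto simp: mult_monom)
    finally show ?thesis using sum True by (simp add: mult.commute)
  next
    case False
    have "T a (n - a) = 0" if "a \<le> n" for a
      using forms_coeff[OF F, of "p + a" "q + (n - a)"] that False by (simp add: T_def)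
    then show ?thesis using sum False by simp
  qed
qed

lemma act_eq_0_iff:
  assumes F: "F \<in> forms d" and \<alpha>: "\<alpha> \<in> forms n"
  shows "\<alpha> \<Zcomp> F = 0 \<longleftrightarrow> (\<forall>p. p + n \<le> d \<longrightarrow> moment (norm_coeff d F) (poly \<alpha> 1 * monom 1 p) = 0)"
proof
  assume zero: "\<alpha> \<Zcomp> F = 0"
  show "\<forall>p. p + n \<le> d \<longrightarrow> moment (norm_coeff d F) (poly \<alpha> 1 * monom 1 p) = 0"
  proof (intro allI impI)
    fix p assume "p + n \<le> d"
    then show "moment (norm_coeff d F) (poly \<alpha> 1 * monom 1 p) = 0"
      using coeff_act[OF F \<alpha>, of "d - n - p" p] zero by (simp split: if_splits)
  qed
next
  assume "\<forall>p. p + n \<le> d \<longrightarrow> moment (norm_coeff d F) (poly \<alpha> 1 * monom 1 p) = 0"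
  then show "\<alpha> \<Zcomp> F = 0"
    by (intro poly_eqI) (auto simp: coeff_act[OF F \<alpha>])
qed

lemma integral_form:
  assumes "F \<in> forms d" "\<alpha> \<in> forms d"
  shows "integral_A F (cls F \<alpha>) = fact d * moment (norm_coeff d F) (poly \<alpha> 1)"
  using integral_cls[OF assms] coeff_act[OF assms, of 0 0]
  by (simp add: const_def)

lemma cls_mult: "cls F \<alpha> \<otimes>\<^bsub>A_alg F\<^esub> cls F \<beta> = cls F (\<alpha> * \<beta>)"
  using ideal.rcoset_mult_add[OF ideal_Ann, of \<alpha> \<beta> F]
  by (simp add: A_alg_def cls_def FactRing_def)

lemma cls_square: "cls F \<alpha> [^]\<^bsub>A_alg F\<^esub> (2 :: nat) = cls F (\<alpha> * \<alpha>)"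
proof -
  interpret cring "A_alg F" by (rule cring_A_alg)
  have "cls F \<alpha> \<in> carrier (A_alg F)"
    by (auto simp: A_alg_def cls_def FactRing_def A_RCOSETS_def' )
  then show ?thesis by (simp add: numeral_2_eq_2 cls_mult)
qed

lemma cls_eq_zero_iff: "cls F \<alpha> = \<zero>\<^bsub>A_alg F\<^esub> \<longleftrightarrow> \<alpha> \<Zcomp> F = 0"
proof -
  have cls: "cls F \<alpha> = (\<lambda>h. h + \<alpha>) ` Ann F"
    by (auto simp: cls_def a_r_coset_def r_coset_def)
  have "cls F \<alpha> = Ann F \<longleftrightarrow> \<alpha> \<Zcomp> F = 0"
  proof
    assume "cls F \<alpha> = Ann F"
    moreover have "0 + \<alpha> \<in> cls F \<alpha>" unfolding cls by (rule imageI) (simp add: Ann_def)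
    ultimately show "\<alpha> \<Zcomp> F = 0" by (simp add: Ann_def)
  next
    assume zero: "\<alpha> \<Zcomp> F = 0"
    have "h - \<alpha> \<in> Ann F" if "h \<in> Ann F" for h
      using act_add_left[of "h - \<alpha>" \<alpha> F] zero that by (simp add: Ann_def)
    then have "h \<in> cls F \<alpha>" if "h \<in> Ann F" for h
      unfolding cls using that by (intro image_eqI[of _ _ "h - \<alpha>"]) auto
    moreover have "cls F \<alpha> \<subseteq> Ann F"
      unfolding cls using zero by (auto simp: Ann_def act_add_left)
    ultimately show "cls F \<alpha> = Ann F" by blast
  qed
  then show ?thesis by (simp add: A_alg_def FactRing_def)
qed

section \<open>Submatrices and increasing enumerations\<close>

lemma pick_image:
  assumes f: "f \<in> idx k m" and a: "a < k"
  shows "pick (f ` {..<k}) a = f a"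
proof -
  have inj: "inj_on f {..<k}"
    using idx_mono[OF f] by (intro linorder_inj_onI) (auto, metis less_irrefl)
  have less: "f x < f a \<longleftrightarrow> x < a" if "x < k" for x
    using idx_mono[OF f, of x a] idx_mono[OF f, of a x] that a by (metis less_asym linorder_neqE_nat less_irrefl)
  have "{y \<in> f ` {..<k}. y < f a} = f ` {..<a}"
    using less a by auto
  moreover have "card (f ` {..<a}) = a"
    using inj_on_subset[OF inj, of "{..<a}"] a by (simp add: card_image)
  ultimately show ?thesis
    using pick_card_in_set[of "f a" "f ` {..<k}"] a by simp
qed

text \<open>An index set corresponds to its enumeration by \<open>pick\<close>, an increasing map to
  its image; \<open>pick_image\<close> recovers the map below \<open>k\<close>.\<close>

lemma totally_nonneg_iff_minors:
  "totally_nonneg (mat m n (\<lambda>(p, q). M p q)) \<longleftrightarrow>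
    (\<forall>k. \<forall>f\<in>idx k m. \<forall>g\<in>idx k n. minor k M f g \<ge> 0)"
proof
  assume tn: "totally_nonneg (mat m n (\<lambda>(p, q). M p q))"
  show "\<forall>k. \<forall>f\<in>idx k m. \<forall>g\<in>idx k n. minor k M f g \<ge> 0"
  proof (intro allI ballI)
    fix k f g assume f: "f \<in> idx k m" and g: "g \<in> idx k n"
    let ?I = "f ` {..<k}" and ?J = "g ` {..<k}"
    have I: "?I \<subseteq> {..<m}" "?J \<subseteq> {..<n}" using f g by (auto simp: idx_def)
    have inj: "inj_on f {..<k}" "inj_on g {..<k}"
      using idx_mono[OF f] idx_mono[OF g] by (auto intro!: linorder_inj_onI) (metis less_irrefl)+
    have card: "card ?I = k" "card ?J = k" using inj by (simp_all add: card_image)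
    have set: "{i. i < m \<and> i \<in> ?I} = ?I" "{j. j < n \<and> j \<in> ?J} = ?J" using I by auto
    have "submatrix (mat m n (\<lambda>(p, q). M p q)) ?I ?J = mat k k (\<lambda>(a, b). M (f a) (g b))"
      unfolding submatrix_def using pick_image[OF f] pick_image[OF g] idx_bound[OF f] idx_bound[OF g]
      by (intro eq_matI) (auto simp: set card simp del: image_iff)
    then show "minor k M f g \<ge> 0"
      using tn I card unfolding totally_nonneg_def minor_def by (metis dim_col_mat(1) dim_row_mat(1))
  qed
next
  assume nonneg: "\<forall>k. \<forall>f\<in>idx k m. \<forall>g\<in>idx k n. minor k M f g \<ge> 0"
  show "totally_nonneg (mat m n (\<lambda>(p, q). M p q))"
    unfolding totally_nonneg_def
  proof (intro allI impI)
    fix I J assume IJ: "I \<subseteq> {..<dim_row (mat m n (\<lambda>(p, q). M p q))}"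
      "J \<subseteq> {..<dim_col (mat m n (\<lambda>(p, q). M p q))}" "card I = card J"
    have pick: "pick S \<in> idx (card S) l" if "S \<subseteq> {..<l}" for S l
      using pick_mono_le[of _ S] pick_in_set_le[of _ S] that by (intro idxI) auto
    have idx: "pick I \<in> idx (card I) m" "pick J \<in> idx (card I) n"
      using pick[of I m] pick[of J n] IJ by auto
    have set: "{i. i < m \<and> i \<in> I} = I" "{j. j < n \<and> j \<in> J} = J" using IJ by auto
    have "submatrix (mat m n (\<lambda>(p, q). M p q)) I J =
        mat (card I) (card I) (\<lambda>(a, b). M (pick I a) (pick J b))"
      unfolding submatrix_def using idx_bound[OF idx(1)] idx_bound[OF idx(2)] IJ(3)
      by (intro eq_matI) (auto simp: set)
    then show "det (submatrix (mat m n (\<lambda>(p, q). M p q)) I J) \<ge> 0"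
      using nonneg idx unfolding minor_def by simp
  qed
qed

lemma totally_nonneg_toeplitz_iff:
  "totally_nonneg (toeplitz d j F) \<longleftrightarrow>
    (\<forall>k. \<forall>f\<in>idx k (Suc j). \<forall>g\<in>idx k (d - j + 1). minor k (toeplitz_entry (norm_coeff d F) 1 j) f g \<ge> 0)"
proof -
  have "toeplitz d j F = mat (Suc j) (d - j + 1) (\<lambda>(p, q). toeplitz_entry (norm_coeff d F) 1 j p q)"
    by (simp add: toeplitz_def toeplitz_entry_1)
  then show ?thesis by (simp only: totally_nonneg_iff_minors)
qed

theorem theorem6p1:
  fixes d i :: nat and F :: bipoly
  assumes "F \<in> forms d" and "i \<le> d div 2"
  shows "(totally_nonneg (toeplitz d i F) \<longrightarrow> mixed_HRR d F i positive_linear_forms) \<and>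
         (totally_nonneg (toeplitz d i F) \<longleftrightarrow> strongly_totally_nonneg_toeplitz d i F)"
proof (intro conjI impI iffI)
  note F = assms(1)
  let ?c = "norm_coeff d F"
  assume "totally_nonneg (toeplitz d i F)"
  then have nonneg: "minor k (toeplitz_entry ?c 1 i) f g \<ge> 0"
    if "f \<in> idx k (Suc i)" "g \<in> idx k (d - i + 1)" for k f g
    using that unfolding totally_nonneg_toeplitz_iff by blast
  show "mixed_HRR d F i positive_linear_forms"
    unfolding mixed_HRR_def
  proof (intro allI impI ballI)
    fix l :: "nat \<Rightarrow> bipoly" and j A
    assume l: "\<forall>k\<le>d. l k \<in> positive_linear_forms" and j: "j \<le> i" and A: "A \<in> A_deg F j"
      and nz: "A \<noteq> \<zero>\<^bsub>A_alg F\<^esub>"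
      and prim: "cls F (\<Prod>k=0..d - 2*j. l k) \<otimes>\<^bsub>A_alg F\<^esub> A = \<zero>\<^bsub>A_alg F\<^esub>"
    obtain \<alpha> where \<alpha>: "\<alpha> \<in> forms j" "A = cls F \<alpha>" using A by (auto simp: A_deg_def)
    have jd: "2 * j \<le> d" using j assms(2) by linarith
    have l': "l k \<in> forms 1" "poly (l k) 1 \<in> pos_lin" if "k \<le> d" for k
      using dehom_positive_linear l that by blast+
    have w0: "(\<Prod>k=0..d - 2*j. l k) * \<alpha> \<in> forms (Suc (d - 2 * j) + j)"
    proof (rule forms_mult[OF _ \<alpha>(1)])
      have "(\<Prod>k=0..d - 2*j. l k) \<in> forms (card {0..d - 2 * j})"
        by (rule forms_prod, rule l'(1)) auto
      then show "(\<Prod>k=0..d - 2*j. l k) \<in> forms (Suc (d - 2 * j))" by simp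
    qed
    have w: "(\<Prod>k=1..d - 2*j. l k) * (\<alpha> * \<alpha>) \<in> forms d"
    proof -
      have "(\<Prod>k=1..d - 2*j. l k) \<in> forms (card {1..d - 2 * j})"
        by (rule forms_prod, rule l'(1)) auto
      then have "(\<Prod>k=1..d - 2*j. l k) * (\<alpha> * \<alpha>) \<in> forms (d - 2 * j + (j + j))"
        by (intro forms_mult \<alpha>(1)) simp
      then show ?thesis using jd by simp
    qed
    have "\<not> \<alpha> \<Zcomp> F = 0" using nz \<alpha>(2) cls_eq_zero_iff by blast
    then obtain p where p: "p + j \<le> d" "moment ?c (poly \<alpha> 1 * monom 1 p) \<noteq> 0"
      unfolding act_eq_0_iff[OF F \<alpha>(1)] by blast
    have "((\<Prod>k=0..d - 2*j. l k) * \<alpha>) \<Zcomp> F = 0"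
      using prim unfolding \<alpha>(2) cls_mult cls_eq_zero_iff .
    \<comment> \<open>The product is a form of degree \<open>d - j + 1\<close>, so
      \<open>act_eq_0_iff\<close> tests it on exactly the powers \<open>b < j\<close>.\<close>
    then have prim': "moment ?c ((\<Prod>k=0..d - 2 * j. poly (l k) 1) * poly \<alpha> 1 * monom 1 b) = 0" if "b < j" for b
      unfolding act_eq_0_iff[OF F w0] using that jd by (simp add: poly_prod)
    have "(-1) ^ j * moment ?c ((\<Prod>k=1..d - 2 * j. poly (l k) 1) * poly \<alpha> 1 * poly \<alpha> 1) > 0"
      by (rule primitive_positive[OF j assms(2) nonneg l'(2) degree_dehom[OF \<alpha>(1)] _ p(2) prim'])
         (use p(1) in auto)
    then have "fact d * ((-1) ^ j * moment ?c (poly ((\<Prod>k=1..d - 2*j. l k) * (\<alpha> * \<alpha>)) 1)) > 0"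
      by (simp add: poly_prod mult.assoc)
    then show "(-1) ^ j * integral_A F (cls F (\<Prod>k=1..d - 2*j. l k) \<otimes>\<^bsub>A_alg F\<^esub> (A [^]\<^bsub>A_alg F\<^esub> (2::nat))) > 0"
      unfolding \<alpha>(2) cls_square cls_mult integral_form[OF F w] by (simp only: mult.left_commute)
  qed
  obtain r where r: "\<And>k. k \<le> r \<Longrightarrow> minors_pos k (toeplitz_entry ?c 1 i) (Suc i) (d - i + 1)"
    "\<And>k. r < k \<Longrightarrow> minors_zero k (toeplitz_entry ?c 1 i) (Suc i) (d - i + 1)"
    using totally_nonneg_rank[OF nonneg] by blast
  show "strongly_totally_nonneg_toeplitz d i F"
    unfolding strongly_totally_nonneg_toeplitz_def totally_nonneg_toeplitz_iff
  proof (intro allI impI ballI)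
    fix j k f g assume j: "j \<le> i" and fg: "f \<in> idx k (Suc j)" "g \<in> idx k (d - j + 1)"
    note down = toeplitz_minors_down[OF j assms(2) r(1) r(2)[OF lessI]]
    show "minor k (toeplitz_entry ?c 1 j) f g \<ge> 0"
    \<comment> \<open>Minors of size up to the rank are limits of positive ones; larger ones
      vanish.\<close>
    proof (cases "k \<le> r")
      case True
      then show ?thesis using down(1) fg by blast
    next
      case False
      then show ?thesis using down(2)[of k] fg unfolding minors_zero_def by simp
    qed
  qed
qed (simp add: strongly_totally_nonneg_toeplitz_def)

end
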